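(* Let $n\ge 2$, $r\ge1$, and let $k,q_1,\ldots,q_r,\epsilon_0,\ldots,\epsilon_{r-1}$ be integers. Then the cyclic presentation \[\mathcal{G}_n\big(x_1^{\epsilon_0}x_{1+q_1}^{\epsilon_1}\cdots x_{1+q_{r-1}}^{\epsilon_{r-1}}x_{1+q_r}\,(x_{1+k}^{\epsilon_0}x_{1+k+q_1}^{\epsilon_1}\cdots x_{1+k+q_{r-1}}^{\epsilon_{r-1}})^{-1}\big)\] is homotopy equivalent to the cyclic presentation \[\mathcal{G}_n\big((y_1^{-1}y_{1+k})^{\epsilon_0}(y_{1+q_1}^{-1}y_{1+q_1+k})^{\epsilon_1}\cdots(y_{1+q_{r-1}}^{-1}y_{1+q_{r-1}+k})^{\epsilon_{r-1}}\,y_{1+q_r}^{-1}\big).\] In particular, for $0\le p_0,\ldots,p_{r-1}\le n-1$ and $p_r=-1$, the presentation \[\mathcal{L}_n(p_0,\ldots,p_{r-1})=\mathcal{G}_n\big((x_{p_0}x_{p_1+1}\cdots x_{p_{r-1}+(r-1)}x_{p_r+r})(x_{p_0+1}x_{p_1+2}\cdots x_{p_{r-1}+r})^{-1}\big)\] is homotopy equivalent to \[\mathcal{G}_n\Big(\Big(\prod_{j=0}^{r-1}y_{j+1+(p_j-p_0)}^{-1}\,y_{j+2+(p_j-p_0)}\Big)\,y_{1+r+(p_r-p_0)}^{-1}\Big).\] All subscripts are taken mod $n$.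
   Context: For a word $w$ in the free group on $x_1,\ldots,x_n$, the cyclic presentation is $\mathcal{G}_n(w)=\langle x_1,\ldots,x_n\mid w,\theta(w),\ldots,\theta^{n-1}(w)\rangle$, where $\theta(x_i)=x_{i+1}$ (subscripts mod $n$); similarly for words in $y_1,\ldots,y_n$. Homotopy equivalence of presentations means homotopy equivalence of their standard 2-complexes (one 0-cell, one 1-cell per generator, one 2-cell per relator); in particular homotopy equivalent presentations define isomorphic groups. *)

theory Defs
  imports "HOL-Analysis.Analysis"
begin

text \<open>A letter is a pair (g, b): generator number g (0-based, so g stands for
  x_(g+1)), and b = True for the letter x_(g+1), b = False for its inverse.
  A word is a list of letters (not necessarily freely reduced).\<close>

type_synonym letter = "nat \<times> bool"
type_synonym word = "letter list"

definition winv :: "word \<Rightarrow> word" where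
  "winv w = rev (map (\<lambda>(g, b). (g, \<not> b)) w)"

definition wpow :: "word \<Rightarrow> int \<Rightarrow> word" where
  "wpow w e = (if 0 \<le> e then concat (replicate (nat e) w)
               else concat (replicate (nat (- e)) (winv w)))"

text \<open>The generator x_i (subscript i an integer, taken mod n, generators
  x_1,...,x_n).\<close>
definition gen :: "nat \<Rightarrow> int \<Rightarrow> word" where
  "gen n i = [(nat ((i - 1) mod int n), True)]"

definition xpow :: "nat \<Rightarrow> int \<Rightarrow> int \<Rightarrow> word" where
  "xpow n i e = wpow (gen n i) e"

definition shift :: "nat \<Rightarrow> nat \<Rightarrow> word \<Rightarrow> word" where
  "shift n j w = map (\<lambda>(g, b). ((g + j) mod n, b)) w"

definition cyclic_rels :: "nat \<Rightarrow> word \<Rightarrow> word list" where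
  "cyclic_rels n w = map (\<lambda>j. shift n j w) [0..<n]"

definition quotient_topology :: "'a topology \<Rightarrow> ('a \<Rightarrow> 'b) \<Rightarrow> 'b topology" where
  "quotient_topology X f =
     topology (\<lambda>U. U \<subseteq> f ` topspace X \<and> openin X {x \<in> topspace X. f x \<in> U})"

text \<open>Cells, all living in nat x R^2: index 0 is the 0-cell (a point),
  index Suc g (g < n) is the 1-cell [0,1] x {0} of generator g, and index
  Suc n + i (i < number of relators) is the closed unit disk of relator i.\<close>
definition cell_space :: "nat \<Rightarrow> nat \<Rightarrow> (real \<times> real) topology" where
  "cell_space n i =
     (if i = 0 then subtopology euclidean {(0, 0)}
      else if i \<le> n then subtopology euclidean ({0..1} \<times> {0})
      else subtopology euclidean (cball 0 1))"

definition base_pt :: "nat \<times> (real \<times> real)" where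
  "base_pt = (0, (0, 0))"

definition edge_pt :: "nat \<Rightarrow> real \<Rightarrow> nat \<times> (real \<times> real)" where
  "edge_pt g t = (if t = 0 \<or> t = 1 then base_pt else (Suc g, (t, 0)))"

text \<open>Attaching map of a 2-cell along word w: the boundary point with angle
  parameter s in [0,1) is sent to the 1-skeleton; the circle is divided into
  length w equal arcs, the j-th running along the j-th letter.\<close>
definition attach :: "word \<Rightarrow> real \<Rightarrow> nat \<times> (real \<times> real)" where
  "attach w s =
     (if w = [] then base_pt
      else (let L = real (length w); j = nat \<lfloor>L * s\<rfloor>; u = L * s - real j;
                (g, b) = w ! j
            in edge_pt g (if b then u else 1 - u)))"

definition circ_param :: "real \<times> real \<Rightarrow> real" where
  "circ_param z = (SOME s. 0 \<le> s \<and> s < 1 \<and> z = (cos (2 * pi * s), sin (2 * pi * s)))"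

text \<open>Canonical representative of each point under the identifications.\<close>
definition ident :: "nat \<Rightarrow> word list \<Rightarrow> nat \<times> (real \<times> real) \<Rightarrow> nat \<times> (real \<times> real)" where
  "ident n R p =
     (case p of (i, z) \<Rightarrow>
        if i = 0 then base_pt
        else if i \<le> n then edge_pt (i - 1) (fst z)
        else if norm z = 1 then attach (R ! (i - Suc n)) (circ_param z)
        else p)"

definition pres_complex :: "nat \<Rightarrow> word list \<Rightarrow> (nat \<times> (real \<times> real)) topology" where
  "pres_complex n R =
     quotient_topology (sum_topology (cell_space n) {0..n + length R}) (ident n R)"

definition pres_homotopy_equivalent :: "nat \<Rightarrow> word list \<Rightarrow> nat \<Rightarrow> word list \<Rightarrow> bool" where
  "pres_homotopy_equivalent n R m S \<longleftrightarrow>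
     pres_complex n R homotopy_equivalent_space pres_complex m S"

definition cyc_hequiv :: "nat \<Rightarrow> word \<Rightarrow> word \<Rightarrow> bool" where
  "cyc_hequiv n w v = pres_homotopy_equivalent n (cyclic_rels n w) n (cyclic_rels n v)"

end

theory Submission
  imports Defs
begin

text \<open>Adjoin generators y_i together with relators y_i = W_i, where W_i is the word
  x_i^(e_0) x_(i+q_1)^(e_1) ... in the relators, to the first presentation. Its relators become
  y_i x_(i+q_r) = y_(i+k), which, read as x_(i+q_r) = y_i^-1 y_(i+k), allow one to eliminate the x_i instead;
  the relators y_i = W_i then turn into those of the second presentation.
  Geometrically, two facts are needed: the homotopy type is unchanged when attaching
  maps of 2-cells are varied by a homotopy, because both complexes are deformation retracts of
  the space with D x [0,1] attached along the homotopy; and a disc may be collapsed from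
  a free edge, because an arc in its boundary is an absolute retract and the disc is convex.\<close>

section \<open>Pushouts and deformation\<close>

text \<open>All n generators of a family can be eliminated at once because the defining relators do
  not interfere: W_i y_i^-1 contains a single y-letter and y_(i+k)^-1 y_i x_(i+q_r) a single
  x-letter. Hence, in one and the same complex, each half of the relators consists of free faces for
  one family of generators and of ordinary relators for the other, and a single elimination theorem
  is used twice with the roles exchanged. The defined letter is kept in last position, so that the
  rest of the boundary is one arc starting at parameter 0; to reach this form the given relators W_i
  x_(i+q_r) W_(i+k)^-1 are first permuted cyclically, which is again a homotopy of attaching maps,
  by rotation of the circle. The obstacle to collapsing immediately is that an edge is free only if
  no other disc runs over it. The other relators are therefore first pushed off the edge by
  homotopies across the defining discs. Points are handled as normal forms and pushouts by a
  characterising property, so that the spaces obtained by attaching cells are literally complexes of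
  the same kind.\<close>

abbreviation I01 :: "real topology" where
  "I01 \<equiv> top_of_set {0..1}"

text \<open>A property of a cocone rather than a construction, so that a complex of normal forms, or
  a product with an interval, can be recognised as a pushout. The injectivity and disjointness
  clauses fix the point set as X together with E minus S; the last clause, with continuity of i and
  j, fixes the topology as the final one.\<close>

definition pushout ::
  "'a topology \<Rightarrow> 'e topology \<Rightarrow> 'e set \<Rightarrow> ('e \<Rightarrow> 'a) \<Rightarrow> 'z topology \<Rightarrow> ('a \<Rightarrow> 'z) \<Rightarrow> ('e \<Rightarrow> 'z) \<Rightarrow> bool"
  where "pushout X E S \<phi> Z i j \<longleftrightarrow>
    S \<subseteq> topspace E \<and> continuous_map X Z i \<and> continuous_map E Z j \<and>
    (\<forall>e\<in>S. \<phi> e \<in> topspace X \<and> j e = i (\<phi> e)) \<and>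
    inj_on i (topspace X) \<and> inj_on j (topspace E - S) \<and>
    i ` topspace X \<inter> j ` (topspace E - S) = {} \<and>
    topspace Z = i ` topspace X \<union> j ` topspace E \<and>
    (\<forall>U. U \<subseteq> topspace Z \<and> openin X {x \<in> topspace X. i x \<in> U} \<and>
         openin E {e \<in> topspace E. j e \<in> U} \<longrightarrow> openin Z U)"

lemma pushoutD:
  assumes "pushout X E S \<phi> Z i j"
  shows "S \<subseteq> topspace E" "continuous_map X Z i" "continuous_map E Z j"
    "\<And>e. e \<in> S \<Longrightarrow> \<phi> e \<in> topspace X" "\<And>e. e \<in> S \<Longrightarrow> j e = i (\<phi> e)"
    "inj_on i (topspace X)" "inj_on j (topspace E - S)"
    "i ` topspace X \<inter> j ` (topspace E - S) = {}"
    "topspace Z = i ` topspace X \<union> j ` topspace E"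
    "\<And>x. x \<in> topspace X \<Longrightarrow> i x \<in> topspace Z" "\<And>e. e \<in> topspace E \<Longrightarrow> j e \<in> topspace Z"
  using assms unfolding pushout_def by blast+

lemma pushout_openI:
  assumes "pushout X E S \<phi> Z i j" "U \<subseteq> topspace Z" "openin X {x \<in> topspace X. i x \<in> U}"
    "openin E {e \<in> topspace E. j e \<in> U}"
  shows "openin Z U"
  using assms unfolding pushout_def by blast

lemma pushout_map_out:
  assumes po: "pushout X E S \<phi> Z i j"
    and f: "continuous_map X W f" and g: "continuous_map E W g"
    and fg: "\<And>e. e \<in> S \<Longrightarrow> g e = f (\<phi> e)"
  obtains F where "continuous_map Z W F" "\<And>x. x \<in> topspace X \<Longrightarrow> F (i x) = f x"
    "\<And>e. e \<in> topspace E \<Longrightarrow> F (j e) = g e"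
proof -
  note po' = pushoutD[OF po]
  define F where "F z = (if z \<in> i ` topspace X then f (inv_into (topspace X) i z)
                         else g (inv_into (topspace E - S) j z))" for z
  have Fi: "F (i x) = f x" if "x \<in> topspace X" for x
    using that po'(6) by (simp add: F_def)
  have Fj: "F (j e) = g e" if "e \<in> topspace E" for e
  proof (cases "e \<in> S")
    case True
    then show ?thesis using Fi po'(4,5) fg by simp
  next
    case False
    then have "j e \<notin> i ` topspace X" using that po'(8) by blast
    then show ?thesis using that False po'(7) by (simp add: F_def)
  qed
  have "continuous_map Z W F"
    unfolding continuous_map
  proof (intro conjI allI impI)
    show "F ` topspace Z \<subseteq> topspace W"
      unfolding po'(9) using Fi Fj f g by (auto simp: continuous_map_def Pi_iff)
    fix U assume U: "openin W U"
    have 1: "{x \<in> topspace X. i x \<in> {z \<in> topspace Z. F z \<in> U}} = {x \<in> topspace X. f x \<in> U}"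
      using po'(10) Fi by auto
    have 2: "{e \<in> topspace E. j e \<in> {z \<in> topspace Z. F z \<in> U}} = {e \<in> topspace E. g e \<in> U}"
      using po'(11) Fj by auto
    have "openin X {x \<in> topspace X. i x \<in> {z \<in> topspace Z. F z \<in> U}}"
      unfolding 1 using f U by (simp add: continuous_map)
    moreover have "openin E {e \<in> topspace E. j e \<in> {z \<in> topspace Z. F z \<in> U}}"
      unfolding 2 using g U by (simp add: continuous_map)
    ultimately show "openin Z {x \<in> topspace Z. F x \<in> U}"
      by (intro pushout_openI[OF po]) auto
  qed
  then show ?thesis using Fi Fj that by blast
qed

text \<open>One representative is kept per point: all of X on the left, and on the right only E
  minus S, because a point of S is already represented by its image under \<open>\<phi>\<close>.
  This serves where no ready-made model is at hand, namely for cylinders glued along a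
  homotopy.\<close>

lemma pushout_exists:
  fixes X :: "'a topology" and E :: "'e topology"
  assumes S: "S \<subseteq> topspace E" and \<phi>: "\<And>e. e \<in> S \<Longrightarrow> \<phi> e \<in> topspace X"
  shows "\<exists>(Z :: ('a + 'e) topology) i j. pushout X E S \<phi> Z i j"
proof -
  define j where "j e = (if e \<in> S then Inl (\<phi> e) else Inr e)" for e
  define C :: "('a + 'e) set" where "C = Inl ` topspace X \<union> Inr ` (topspace E - S)"
  define P where "P U \<longleftrightarrow> U \<subseteq> C \<and> openin X {x \<in> topspace X. Inl x \<in> U} \<and>
      openin E {e \<in> topspace E. j e \<in> U}" for U
  define Z where "Z = topology P"
  have ist: "istopology P"
    unfolding istopology_def
  proof (intro conjI allI impI)
    fix U V assume "P U" "P V"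
    then have "openin X ({x \<in> topspace X. Inl x \<in> U} \<inter> {x \<in> topspace X. Inl x \<in> V})"
      "openin E ({e \<in> topspace E. j e \<in> U} \<inter> {e \<in> topspace E. j e \<in> V})" "U \<inter> V \<subseteq> C"
      by (auto simp: P_def)
    moreover have "{x \<in> topspace X. Inl x \<in> U} \<inter> {x \<in> topspace X. Inl x \<in> V} =
        {x \<in> topspace X. Inl x \<in> U \<inter> V}"
      "{e \<in> topspace E. j e \<in> U} \<inter> {e \<in> topspace E. j e \<in> V} = {e \<in> topspace E. j e \<in> U \<inter> V}"
      by blast+
    ultimately show "P (U \<inter> V)" by (simp add: P_def)
  next
    fix K assume K: "\<forall>U\<in>K. P U"
    have 1: "{x \<in> topspace X. Inl x \<in> \<Union>K} = \<Union>((\<lambda>U. {x \<in> topspace X. Inl x \<in> U}) ` K)" by auto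
    have 2: "{x \<in> topspace E. j x \<in> \<Union>K} = \<Union>((\<lambda>U. {x \<in> topspace E. j x \<in> U}) ` K)" by auto
    show "P (\<Union>K)"
      unfolding P_def 1 2 using K by (auto simp: P_def intro!: openin_Union)
  qed
  then have openZ: "openin Z U \<longleftrightarrow> P U" for U
    by (simp add: Z_def)
  have "{x \<in> topspace X. Inl x \<in> C} = topspace X" "{e \<in> topspace E. j e \<in> C} = topspace E"
    using \<phi> by (auto simp: C_def j_def)
  then have "P C" by (simp add: P_def)
  then have topZ: "topspace Z = C"
    using openZ by (metis P_def openin_subset openin_topspace subset_antisym)
  have "pushout X E S \<phi> Z Inl j"
    unfolding pushout_def
  proof (intro conjI)
    show "continuous_map X Z Inl"
      unfolding continuous_map topZ openZ using P_def by (auto simp: C_def)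
    show "continuous_map E Z j"
      unfolding continuous_map topZ openZ using P_def \<phi> by (auto simp: C_def j_def)
    show "\<forall>U. U \<subseteq> topspace Z \<and> openin X {x \<in> topspace X. Inl x \<in> U} \<and>
         openin E {e \<in> topspace E. j e \<in> U} \<longrightarrow> openin Z U"
      unfolding topZ openZ P_def by blast
    show "topspace Z = Inl ` topspace X \<union> j ` topspace E"
      unfolding topZ C_def j_def using \<phi> by auto
  qed (use S \<phi> in \<open>auto simp: j_def inj_on_def\<close>)
  then show ?thesis by blast
qed

text \<open>The tube lemma makes the product of a quotient map with a compact interval a quotient map.\<close>
lemma pushout_prod_interval:
  assumes po: "pushout X E S \<phi> Z i j"
  shows "pushout (prod_topology I01 X) (prod_topology I01 E) ({0..1} \<times> S) (\<lambda>(t,e). (t, \<phi> e))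
           (prod_topology I01 Z) (\<lambda>(t,x). (t, i x)) (\<lambda>(t,e). (t, j e))"
proof -
  note po' = pushoutD[OF po]
  have ci: "continuous_map (prod_topology I01 X) (prod_topology I01 Z) (\<lambda>(t,x). (t, i x))"
    using po'(2,3) by (simp add: continuous_map_prod_top)
  have cj: "continuous_map (prod_topology I01 E) (prod_topology I01 Z) (\<lambda>(t,e). (t, j e))"
    using po'(2,3) by (simp add: continuous_map_prod_top)
  \<comment> \<open>Tube lemma: projection along the compact C is a closed map, so the points y
    whose slice over C leaves V form a closed set.\<close>
  have tube: "openin Y {y \<in> topspace Y. \<forall>t\<in>C. (t, y) \<in> V}"
    if V: "openin (prod_topology I01 Y) V" and C: "C \<subseteq> {0..1}" "compact C" for Y :: "'y topology" and C V
  proof -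
    let ?K = "prod_topology (top_of_set C) Y"
    have K: "?K = subtopology (prod_topology I01 Y) (C \<times> topspace Y)"
      using C by (simp add: subtopology_Times subtopology_subtopology Int_absorb1)
    have "openin ?K ((C \<times> topspace Y) \<inter> V)"
      unfolding K using V openin_subtopology_Int2 by blast
    then have "closedin ?K (topspace ?K - (C \<times> topspace Y) \<inter> V)"
      by blast
    then have "closedin Y (snd ` (topspace ?K - (C \<times> topspace Y) \<inter> V))"
      using C closed_map_snd[of "top_of_set C" Y] unfolding closed_map_def
      by (simp add: compact_space_subtopology)
    moreover have "{y \<in> topspace Y. \<forall>t\<in>C. (t, y) \<in> V} =
        topspace Y - snd ` (topspace ?K - (C \<times> topspace Y) \<inter> V)"
      by (force simp: image_iff)
    ultimately show ?thesis by auto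
  qed
  have slice: "openin I01 {t \<in> {0..1}. (t, y) \<in> V}"
    if V: "openin (prod_topology I01 Y) V" "y \<in> topspace Y" for Y :: "'y topology" and y V
  proof -
    have "continuous_map I01 (prod_topology I01 Y) (\<lambda>t. (t, y))"
      using that by (simp add: continuous_map_pairedI)
    then show ?thesis using V by (auto simp: continuous_map)
  qed
  have op: "openin (prod_topology I01 Z) U"
    if U: "U \<subseteq> {0..1} \<times> topspace Z"
      and V1: "openin (prod_topology I01 X) {p \<in> topspace (prod_topology I01 X). (case p of (t,x) \<Rightarrow> (t, i x)) \<in> U}"
      and V2: "openin (prod_topology I01 E) {p \<in> topspace (prod_topology I01 E). (case p of (t,x) \<Rightarrow> (t, j x)) \<in> U}"
    for U
    unfolding openin_prod_topology_alt
  proof (intro allI impI)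
    fix t z assume tz: "(t, z) \<in> U"
    then have t: "t \<in> {0..1}" and z: "z \<in> topspace Z" using U by auto
    have "openin I01 {t \<in> {0..1}. (t, z) \<in> U}"
    proof -
      consider x where "x \<in> topspace X" "z = i x" | e where "e \<in> topspace E" "z = j e"
        using z po'(9) by auto
      then show ?thesis
      proof cases
        case 1
        then show ?thesis using slice[OF V1, of x] by (simp cong: conj_cong)
      next
        case 2
        then show ?thesis using slice[OF V2, of e] by (simp cong: conj_cong)
      qed
    qed
    then obtain d where d: "d > 0" "\<And>s. s \<in> {0..1} \<Longrightarrow> dist s t < d \<Longrightarrow> (s, z) \<in> U"
      using t tz unfolding openin_euclidean_subtopology_iff by (auto simp: dist_commute)
    \<comment> \<open>Half the radius makes the closed ball fit into the open d-ball around t. Thus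
      z lies in V, and V is open because its two preimages are tubes over the compact C.\<close>
    define C where "C = cball t (d/2) \<inter> {0..1}"
    have C: "C \<subseteq> {0..1}" "compact C" by (auto simp: C_def compact_Int)
    define V where "V = {z \<in> topspace Z. \<forall>s\<in>C. (s, z) \<in> U}"
    have "openin Z V"
    proof -
      have "{x \<in> topspace X. i x \<in> V} = {x \<in> topspace X. \<forall>s\<in>C. (s, x) \<in>
          {p \<in> topspace (prod_topology I01 X). (case p of (t,x) \<Rightarrow> (t, i x)) \<in> U}}"
        using po'(10,11) C by (auto simp: V_def)
      moreover have "{x \<in> topspace E. j x \<in> V} = {x \<in> topspace E. \<forall>s\<in>C. (s, x) \<in>
          {p \<in> topspace (prod_topology I01 E). (case p of (t,x) \<Rightarrow> (t, j x)) \<in> U}}"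
        using po'(10,11) C by (auto simp: V_def)
      ultimately have "openin X {x \<in> topspace X. i x \<in> V}" "openin E {x \<in> topspace E. j x \<in> V}"
        using tube[OF V1 C] tube[OF V2 C] by simp_all
      moreover have "V \<subseteq> topspace Z" by (auto simp: V_def)
      ultimately show ?thesis using pushout_openI[OF po] by blast
    qed
    moreover have "openin I01 (ball t (d/2) \<inter> {0..1})"
      by (simp add: Int_commute openin_open_Int)
    moreover have "z \<in> V" using z d by (auto simp: V_def C_def dist_commute)
    moreover have "(ball t (d/2) \<inter> {0..1}) \<times> V \<subseteq> U"
      by (auto simp: V_def C_def)
    ultimately show "\<exists>A B. openin I01 A \<and> openin Z B \<and> t \<in> A \<and> z \<in> B \<and> A \<times> B \<subseteq> U"
      using t d by (intro exI[of _ "ball t (d/2) \<inter> {0..1}"] exI[of _ V]) auto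
  qed
  show ?thesis
    unfolding pushout_def
  proof (intro conjI)
    show "\<forall>U. U \<subseteq> topspace (prod_topology I01 Z) \<and>
        openin (prod_topology I01 X) {p \<in> topspace (prod_topology I01 X). (case p of (t,x) \<Rightarrow> (t, i x)) \<in> U} \<and>
        openin (prod_topology I01 E) {p \<in> topspace (prod_topology I01 E). (case p of (t,x) \<Rightarrow> (t, j x)) \<in> U} \<longrightarrow>
        openin (prod_topology I01 Z) U"
      using op by simp
  qed (use po' ci cj in \<open>auto simp: inj_on_def image_iff\<close>)
qed

text \<open>The deformation \<open>h\<close> of E into J fixes S, so it glues with the constant
  homotopy of X to a homotopy of Z. The space Z' is given by its own maps \<open>i'\<close>,
  \<open>\<rho>\<close> and \<open>F\<close>, not as a subspace of Z, because in the applications it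
  is a complex with its own names for points. The composite on Z' is exactly the identity, as
  \<open>h\<close> at time 1 fixes J.\<close>

lemma pushout_deformation:
  assumes po: "pushout X E S \<Phi> Z i j"
    and h: "continuous_map (prod_topology I01 E) E h"
      "\<And>e. e \<in> topspace E \<Longrightarrow> h (0, e) = e"
      "\<And>e. e \<in> topspace E \<Longrightarrow> h (1, e) \<in> J"
      "\<And>e. e \<in> J \<Longrightarrow> h (1, e) = e"
      "\<And>t e. t \<in> {0..1} \<Longrightarrow> e \<in> S \<Longrightarrow> h (t, e) = e"
    and SJ: "S \<subseteq> J" "J \<subseteq> topspace E"
    and i': "continuous_map X Z' i'"
    and \<rho>: "continuous_map (subtopology E J) Z' \<rho>" "\<And>e. e \<in> S \<Longrightarrow> \<rho> e = i' (\<Phi> e)"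
    and F: "continuous_map Z' Z F" "\<And>x. x \<in> topspace X \<Longrightarrow> F (i' x) = i x" "\<And>e. e \<in> J \<Longrightarrow> F (\<rho> e) = j e"
    and Z': "topspace Z' \<subseteq> i' ` topspace X \<union> \<rho> ` J"
  shows "Z homotopy_equivalent_space Z'"
proof -
  note po' = pushoutD[OF po]
  have "continuous_map E (subtopology E J) (\<lambda>e. h (1, e))"
  proof -
    have "continuous_map E E (h \<circ> (\<lambda>e. (1, e)))"
      by (intro continuous_map_compose[OF _ h(1)] continuous_map_pairedI) auto
    then show ?thesis using h(3) by (auto simp: continuous_map_in_subtopology o_def)
  qed
  then have "continuous_map E Z' (\<rho> \<circ> (\<lambda>e. h (1, e)))"
    using \<rho>(1) continuous_map_compose by blast
  then obtain R where R: "continuous_map Z Z' R" "\<And>x. x \<in> topspace X \<Longrightarrow> R (i x) = i' x"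
      "\<And>e. e \<in> topspace E \<Longrightarrow> R (j e) = \<rho> (h (1, e))"
    using pushout_map_out[OF po i', of "\<rho> \<circ> (\<lambda>e. h (1, e))"] SJ h(5) \<rho>(2) by (auto simp: subset_iff)
  have "continuous_map (prod_topology I01 X) Z (i \<circ> snd)" "continuous_map (prod_topology I01 E) Z (j \<circ> h)"
    using po' h(1) by (auto intro: continuous_map_compose continuous_map_snd)
  from pushout_map_out[OF pushout_prod_interval[OF po] this] po' h(5)
  obtain H where H: "continuous_map (prod_topology I01 Z) Z H"
      "\<And>p. p \<in> topspace (prod_topology I01 X) \<Longrightarrow> H (case p of (t, x) \<Rightarrow> (t, i x)) = (i \<circ> snd) p"
      "\<And>p. p \<in> topspace (prod_topology I01 E) \<Longrightarrow> H (case p of (t, x) \<Rightarrow> (t, j x)) = (j \<circ> h) p"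
    by (smt (verit) SigmaE case_prod_conv comp_apply snd_conv)
  have Hi: "H (t, i x) = i x" if "t \<in> {0..1}" "x \<in> topspace X" for t x
    using H(2)[of "(t,x)"] that by auto
  have Hj: "H (t, j e) = j (h (t, e))" if "t \<in> {0..1}" "e \<in> topspace E" for t e
    using H(3)[of "(t,e)"] that by auto
  have RF: "R (F z) = z" if z: "z \<in> topspace Z'" for z
  proof -
    consider x where "x \<in> topspace X" "z = i' x" | e where "e \<in> J" "z = \<rho> e"
      using z Z' by blast
    then show ?thesis using F R h(4) SJ by cases (auto simp: subset_iff)
  qed
  have H0: "H (0, z) = z" and H1: "H (1, z) = F (R z)" if z: "z \<in> topspace Z" for z
  proof -
    consider x where "x \<in> topspace X" "z = i x" | e where "e \<in> topspace E" "z = j e"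
      using z po'(9) by blast
    then show "H (0, z) = z" "H (1, z) = F (R z)"
      by (cases; use Hi Hj h F R in auto)+
  qed
  have "homotopic_with (\<lambda>x. True) Z Z id (F \<circ> R)"
  proof (subst homotopic_with, simp, intro exI conjI)
    show "continuous_map (prod_topology I01 Z) Z H" by fact
  qed (use H0 H1 in auto)
  moreover have "homotopic_with (\<lambda>x. True) Z' Z' (R \<circ> F) id"
    using RF F(1) R(1) by (intro homotopic_with_equal) (auto intro: continuous_map_compose)
  ultimately show ?thesis
    unfolding homotopy_equivalent_space_def using F(1) R(1)
    by (meson homotopic_with_symD)
qed

section \<open>Loops and words\<close>

definition loop_homotopic :: "'a topology \<Rightarrow> 'a \<Rightarrow> (real \<Rightarrow> 'a) \<Rightarrow> (real \<Rightarrow> 'a) \<Rightarrow> bool" where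
  "loop_homotopic X b p q \<longleftrightarrow> homotopic_with (\<lambda>f. f 0 = b \<and> f 1 = b) I01 X p q"

lemma loop_homotopic:
  "loop_homotopic X b p q \<longleftrightarrow> (\<exists>h. continuous_map (prod_topology I01 I01) X h \<and>
     (\<forall>x\<in>{0..1}. h (0,x) = p x) \<and> (\<forall>x\<in>{0..1}. h (1,x) = q x) \<and>
     (\<forall>t\<in>{0..1}. h (t,0) = b \<and> h (t,1) = b))"
  unfolding loop_homotopic_def by (subst homotopic_with) auto

lemma loop_homotopic_eqI:
  assumes "continuous_map I01 X p" "p 0 = b" "p 1 = b" "\<And>x. x \<in> {0..1} \<Longrightarrow> p x = q x"
  shows "loop_homotopic X b p q"
  using assms unfolding loop_homotopic_def by (intro homotopic_with_equal) auto

lemma loop_homotopic_sym: "loop_homotopic X b p q \<Longrightarrow> loop_homotopic X b q p"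
  unfolding loop_homotopic_def by (rule homotopic_with_symD)

lemma loop_homotopic_trans [trans]:
  "loop_homotopic X b p q \<Longrightarrow> loop_homotopic X b q r \<Longrightarrow> loop_homotopic X b p r"
  unfolding loop_homotopic_def by (rule homotopic_with_trans)

lemma loop_homotopicD:
  assumes "loop_homotopic X b p q"
  shows "continuous_map I01 X p" "continuous_map I01 X q"
    "p 0 = b" "p 1 = b" "q 0 = b" "q 1 = b"
proof -
  show "continuous_map I01 X p" "continuous_map I01 X q"
    using assms homotopic_with_imp_continuous_maps unfolding loop_homotopic_def by blast+
  show "p 0 = b" "p 1 = b" "q 0 = b" "q 1 = b"
    using homotopic_with_imp_property[OF assms[unfolded loop_homotopic_def]] by auto
qed

text \<open>An interval is convex, so f and g can be interpolated linearly, and their agreement at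
  the ends keeps the base point. Associativity, units and the comparison of equal arcs with halved
  intervals all reduce to this.\<close>

lemma loop_homotopic_reparam:
  assumes p: "continuous_map I01 X p"
    and f: "continuous_on {0..1} f" "f \<in> {0..1} \<rightarrow> {0..1}"
    and g: "continuous_on {0..1} g" "g \<in> {0..1} \<rightarrow> {0..1}"
    and fg: "f 0 = g 0" "f 1 = g 1" "p (f 0) = b" "p (f 1) = b"
  shows "loop_homotopic X b (\<lambda>s. p (f s)) (\<lambda>s. p (g s))"
  unfolding loop_homotopic
proof (intro exI conjI ballI)
  let ?k = "\<lambda>z::real\<times>real. (1 - fst z) * f (snd z) + fst z * g (snd z)"
  have "continuous_on ({0..1} \<times> {0..1}) ?k"
    by (intro continuous_intros continuous_on_compose2[OF f(1)] continuous_on_compose2[OF g(1)]) auto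
  moreover have "?k z \<in> {0..1}" if "z \<in> {0..1} \<times> {0..1}" for z
    using that f(2) g(2) convexD_alt[of "{0..1::real}" "f (snd z)" "g (snd z)" "fst z"]
    by (auto simp: Pi_iff)
  ultimately have "continuous_map (prod_topology I01 I01) I01 ?k"
    by (auto simp: prod_topology_subtopology_eu)
  then show "continuous_map (prod_topology I01 I01) X (p \<circ> ?k)"
    using p continuous_map_compose by blast
  fix t :: real assume "t \<in> {0..1}"
  show "(p \<circ> ?k) (t, 0) = b" "(p \<circ> ?k) (t, 1) = b"
    using fg by (simp_all add: algebra_simps)
qed auto

definition jn :: "(real \<Rightarrow> 'a) \<Rightarrow> (real \<Rightarrow> 'a) \<Rightarrow> real \<Rightarrow> 'a" where
  "jn p q t = (if t \<le> 1/2 then p (2 * t) else q (2 * t - 1))"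

text \<open>The parameter space Y lets one gluing argument serve twice: a one-point Y joins loops,
  and the unit interval as Y joins homotopies.\<close>

lemma continuous_map_jn_gen:
  assumes p: "continuous_map (prod_topology Y I01) X p" and q: "continuous_map (prod_topology Y I01) X q"
    and pq: "\<And>y. y \<in> topspace Y \<Longrightarrow> p (y, 1) = q (y, 0)"
  shows "continuous_map (prod_topology Y I01) X (\<lambda>(y,t). jn (\<lambda>s. p (y, s)) (\<lambda>s. q (y, s)) t)"
proof -
  have c: "continuous_map (prod_topology Y I01) euclideanreal (\<lambda>z. snd z)"
    using continuous_map_compose[OF continuous_map_snd continuous_map_from_subtopology[OF continuous_map_id], of Y euclideanreal "{0..1}"]
    by (simp add: o_def)
  have "continuous_map (prod_topology Y I01) X
      (\<lambda>z. if snd z \<le> 1/2 then p (fst z, 2 * snd z) else q (fst z, 2 * snd z - 1))"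
  proof (rule continuous_map_cases_le)
    show "continuous_map (subtopology (prod_topology Y I01) {x \<in> topspace (prod_topology Y I01). snd x \<le> 1/2}) X
       (\<lambda>z. p (fst z, 2 * snd z))"
      by (rule continuous_map_compose[OF _ p, unfolded o_def])
         (auto intro!: continuous_map_pairedI continuous_map_from_subtopology[OF continuous_map_fst]
           continuous_map_into_subtopology continuous_map_real_mult continuous_map_from_subtopology[OF c])
    show "continuous_map (subtopology (prod_topology Y I01) {x \<in> topspace (prod_topology Y I01). 1/2 \<le> snd x}) X
       (\<lambda>z. q (fst z, 2 * snd z - 1))"
      by (rule continuous_map_compose[OF _ q, unfolded o_def])
         (auto intro!: continuous_map_pairedI continuous_map_from_subtopology[OF continuous_map_fst]
           continuous_map_into_subtopology continuous_map_real_mult continuous_map_diff continuous_map_from_subtopology[OF c])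
    fix z assume z: "z \<in> topspace (prod_topology Y I01)" "snd z = 1/2"
    then obtain y where "z = (y, 1/2)" "y \<in> topspace Y" by (cases z) auto
    then show "p (fst z, 2 * snd z) = q (fst z, 2 * snd z - 1)"
      using pq by simp
  qed (use c in auto)
  then show ?thesis by (simp add: jn_def case_prod_unfold)
qed

lemma continuous_map_jn:
  assumes p: "continuous_map I01 X p" and q: "continuous_map I01 X q" and pq: "p 1 = q 0"
  shows "continuous_map I01 X (jn p q)"
proof -
  let ?Y = "discrete_topology {()}"
  have "continuous_map (prod_topology ?Y I01) X (\<lambda>(y,t). jn (\<lambda>s. (p \<circ> snd) (y, s)) (\<lambda>s. (q \<circ> snd) (y, s)) t)"
    using continuous_map_compose[OF continuous_map_snd p] continuous_map_compose[OF continuous_map_snd q] pq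
    by (intro continuous_map_jn_gen) (auto simp: o_def)
  moreover have "continuous_map I01 (prod_topology ?Y I01) (\<lambda>t. ((), t))"
    by (intro continuous_map_pairedI) auto
  ultimately have "continuous_map I01 X ((\<lambda>(y,t). jn (\<lambda>s. (p \<circ> snd) (y, s)) (\<lambda>s. (q \<circ> snd) (y, s)) t) \<circ> (\<lambda>t. ((), t)))"
    by (rule continuous_map_compose[rotated])
  then show ?thesis by (simp add: o_def)
qed

lemma jn_0 [simp]: "jn p q 0 = p 0" and jn_1 [simp]: "jn p q 1 = q 1"
  by (auto simp: jn_def)

lemma loop_homotopic_jn:
  assumes "loop_homotopic X b p p'" "loop_homotopic X b q q'"
  shows "loop_homotopic X b (jn p q) (jn p' q')"
proof -
  obtain h k where h: "continuous_map (prod_topology I01 I01) X h"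
      "\<forall>x\<in>{0..1}. h (0,x) = p x" "\<forall>x\<in>{0..1}. h (1,x) = p' x" "\<forall>t\<in>{0..1}. h (t,0) = b \<and> h (t,1) = b"
    and k: "continuous_map (prod_topology I01 I01) X k"
      "\<forall>x\<in>{0..1}. k (0,x) = q x" "\<forall>x\<in>{0..1}. k (1,x) = q' x" "\<forall>t\<in>{0..1}. k (t,0) = b \<and> k (t,1) = b"
    using assms unfolding loop_homotopic by auto
  show ?thesis
    unfolding loop_homotopic
  proof (intro exI conjI)
    show "continuous_map (prod_topology I01 I01) X (\<lambda>(y,t). jn (\<lambda>s. h (y, s)) (\<lambda>s. k (y, s)) t)"
      using h k by (intro continuous_map_jn_gen) auto
  qed (use h k in \<open>auto simp: jn_def\<close>)
qed

lemma loop_homotopic_jn_assoc: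
  assumes "continuous_map I01 X p" "continuous_map I01 X q" "continuous_map I01 X r"
    "p 0 = b" "p 1 = b" "q 0 = b" "q 1 = b" "r 0 = b" "r 1 = b"
  shows "loop_homotopic X b (jn (jn p q) r) (jn p (jn q r))"
proof -
  \<comment> \<open>The left bracketing spends 1/4, 1/4, 1/2 of the time on p, q, r, the right one
    1/2, 1/4, 1/4. The slopes 2, 1, 1/2 of the comparison map decrease, so it is the minimum of its
    three linear pieces.\<close>
  let ?f = "\<lambda>t::real. min (2 * t) (min (t + 1/4) ((t + 1) / 2))"
  have "jn (jn p q) r s = jn p (jn q r) (?f s)" if "s \<in> {0..1}" for s
  proof -
    consider "s \<le> 1/4" | "1/4 < s" "s \<le> 1/2" | "1/2 < s" by linarith
    then show ?thesis
    proof cases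
      case 1
      then have "?f s = 2 * s" by (simp add: min_def)
      then show ?thesis using 1 by (simp add: jn_def)
    next
      case 2
      then have "?f s = s + 1/4" by (simp add: min_def)
      then show ?thesis using 2 by (simp add: jn_def algebra_simps)
    next
      case 3
      then have "?f s = (s + 1) / 2" by (simp add: min_def)
      then show ?thesis using 3 by (simp add: jn_def add_divide_distrib algebra_simps)
    qed
  qed
  then have "loop_homotopic X b (jn (jn p q) r) (\<lambda>s. jn p (jn q r) (?f s))"
    using assms by (intro loop_homotopic_eqI continuous_map_jn) auto
  also have "loop_homotopic X b (\<lambda>s. jn p (jn q r) (?f s)) (\<lambda>s. jn p (jn q r) s)"
    using assms by (intro loop_homotopic_reparam continuous_map_jn continuous_intros) (auto simp: min_def)
  finally show ?thesis by simp
qed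

lemma loop_homotopic_jn_const_left:
  assumes "continuous_map I01 X p" "p 0 = b" "p 1 = b"
  shows "loop_homotopic X b (jn (\<lambda>_. b) p) p"
proof -
  have "b \<in> topspace X" using assms by (auto simp: continuous_map_def Pi_iff)
  moreover have "jn (\<lambda>_. b) p s = p (max 0 (2 * s - 1))" for s
  proof (cases "s = 1/2")
    case True
    show ?thesis unfolding True using assms by (simp add: jn_def)
  qed (use assms in \<open>auto simp: jn_def max_def\<close>)
  ultimately have "loop_homotopic X b (jn (\<lambda>_. b) p) (\<lambda>s. p (max 0 (2 * s - 1)))"
    using assms by (intro loop_homotopic_eqI continuous_map_jn) auto
  also have "loop_homotopic X b (\<lambda>s. p (max 0 (2 * s - 1))) (\<lambda>s. p s)"
    using assms by (intro loop_homotopic_reparam continuous_intros) auto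
  finally show ?thesis by simp
qed

lemma loop_homotopic_jn_const_right:
  assumes "continuous_map I01 X p" "p 0 = b" "p 1 = b"
  shows "loop_homotopic X b (jn p (\<lambda>_. b)) p"
proof -
  have "b \<in> topspace X" using assms by (auto simp: continuous_map_def Pi_iff)
  moreover have "jn p (\<lambda>_. b) s = p (min 1 (2 * s))" for s
  proof (cases "s = 1/2")
    case True
    show ?thesis unfolding True using assms by (simp add: jn_def)
  qed (use assms in \<open>auto simp: jn_def min_def\<close>)
  ultimately have "loop_homotopic X b (jn p (\<lambda>_. b)) (\<lambda>s. p (min 1 (2 * s)))"
    using assms by (intro loop_homotopic_eqI continuous_map_jn) auto
  also have "loop_homotopic X b (\<lambda>s. p (min 1 (2 * s))) (\<lambda>s. p s)"
    using assms by (intro loop_homotopic_reparam continuous_intros) auto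
  finally show ?thesis by simp
qed

datatype 'g pt = Base | Edge 'g real | Disc 'g "real \<times> real"

definition ept :: "'g \<Rightarrow> real \<Rightarrow> 'g pt" where
  "ept g t = (if t = 0 \<or> t = 1 then Base else Edge g t)"

definition letter :: "'g \<times> bool \<Rightarrow> real \<Rightarrow> 'g pt" where
  "letter l u = ept (fst l) (if snd l then u else 1 - u)"

text \<open>The closed-interval version of \<open>attach\<close>: the value at 1 is set to
  \<open>Base\<close> by hand, since the floor would otherwise select a letter with index
  \<open>length w\<close>.\<close>

definition word_path :: "('g \<times> bool) list \<Rightarrow> real \<Rightarrow> 'g pt" where
  "word_path w s = (if w = [] \<or> 1 \<le> s then Base
     else let L = real (length w); j = nat \<lfloor>L * s\<rfloor> in letter (w ! j) (L * s - real j))"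

definition inv_word :: "('g \<times> bool) list \<Rightarrow> ('g \<times> bool) list" where
  "inv_word w = rev (map (\<lambda>(g, b). (g, \<not> b)) w)"

lemma ept_0 [simp]: "ept g 0 = Base" and ept_1 [simp]: "ept g 1 = Base"
  by (auto simp: ept_def)

lemma letter_0 [simp]: "letter l 0 = Base" and letter_1 [simp]: "letter l 1 = Base"
  by (auto simp: letter_def)

lemma letter_inverse: "letter (g, \<not> b) u = letter (g, b) (1 - u)"
  by (auto simp: letter_def)

lemma word_path_Nil [simp]: "word_path [] s = Base"
  by (simp add: word_path_def)

lemma word_path_1 [simp]: "word_path w 1 = Base"
  by (simp add: word_path_def)

lemma word_path_0 [simp]: "word_path w 0 = Base"
  by (simp add: word_path_def)

text \<open>Both ends of the j-th arc are included. At its right end the floor has already moved on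
  to j + 1, but every letter starts and ends at \<open>Base\<close>, so the two formulas agree
  there.\<close>

lemma word_path_nth:
  assumes j: "j < length w" and s: "real j \<le> real (length w) * s" "real (length w) * s \<le> real j + 1"
  shows "word_path w s = letter (w ! j) (real (length w) * s - real j)"
proof -
  have ne: "w \<noteq> []" "0 < real (length w)" using j by auto
  consider "real (length w) * s < real j + 1" | "real (length w) * s = real j + 1" using s by linarith
  then show ?thesis
  proof cases
    case 1
    then have "\<lfloor>real (length w) * s\<rfloor> = int j" using s by linarith
    moreover have "s < 1"
    proof -
      have "real (length w) * s < real (length w) * 1" using 1 j by linarith
      then show ?thesis using ne(2) mult_less_cancel_left_pos by blast
    qed
    ultimately show ?thesis using ne by (simp add: word_path_def Let_def)
  next
    case 2
    then have "\<lfloor>real (length w) * s\<rfloor> = int (j + 1)" by linarith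
    then have "nat \<lfloor>real (length w) * s\<rfloor> = j + 1" by simp
    then show ?thesis using 2 by (simp add: word_path_def Let_def)
  qed
qed

lemma word_path_cases:
  assumes "w \<noteq> []" "s \<in> {0..1}"
  obtains j where "j < length w" "real j \<le> real (length w) * s" "real (length w) * s \<le> real j + 1"
proof (cases "s = 1")
  case True
  with assms show ?thesis by (intro that[of "length w - 1"]) (auto simp: of_nat_diff Suc_leI)
next
  case False
  have "real (length w) * s < real (length w) * 1"
    using False assms by (intro mult_strict_left_mono) auto
  moreover have "0 \<le> real (length w) * s" using assms by simp
  ultimately show ?thesis
    by (intro that[of "nat \<lfloor>real (length w) * s\<rfloor>"]) linarith+
qed

lemma word_path_single: "s \<in> {0..1} \<Longrightarrow> word_path [l] s = letter l s"
  using word_path_nth[of 0 "[l]" s] by simp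

text \<open>\<open>word_path\<close> gives the letter l the fraction 1/L of the time,
  \<open>jn\<close> gives it one half. The comparison map has slope L/2 up to 1/L and slope
  L/(2(L-1)) from there on; the second slope is not larger since L is at least 2, hence the
  minimum.\<close>

lemma word_path_Cons:
  fixes w :: "('g \<times> bool) list"
  assumes w: "w \<noteq> []" and s: "s \<in> {0..1}"
  defines "L \<equiv> real (length w) + 1"
  shows "word_path (l # w) s = jn (letter l) (word_path w) (min (L * s / 2) (1/2 + (L * s - 1) / (2 * (L - 1))))"
proof -
  have L: "L \<ge> 2" using w by (cases w) (auto simp: L_def)
  have len: "real (length (l # w)) = L" by (simp add: L_def)
  show ?thesis
  proof (cases "L * s \<le> 1")
    case True
    have *: "min a (1/2 + c) = a" if "a * 2 - 1 \<le> 2 * c" for a c :: real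
      using that by simp
    have "L * s - 1 \<le> (L * s - 1) / (L - 1)"
      using mult_left_mono_neg[of "1 / (L - 1)" 1 "L * s - 1"] True L by simp
    also have "\<dots> = 2 * ((L * s - 1) / (2 * (L - 1)))"
      using L by (simp add: field_simps)
    finally have m: "min (L * s / 2) (1/2 + (L * s - 1) / (2 * (L - 1))) = L * s / 2"
      by (intro *) simp
    show ?thesis
      unfolding m using True s L len word_path_nth[of 0 "l # w" s] by (simp add: jn_def)
  next
    case False
    let ?m = "1/2 + (L * s - 1) / (2 * (L - 1))"
    have *: "min a (1/2 + c) = 1/2 + c" if "2 * c \<le> a * 2 - 1" for a c :: real
      using that by simp
    have "2 * ((L * s - 1) / (2 * (L - 1))) = (L * s - 1) / (L - 1)"
      using L by (simp add: field_simps)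
    also have "\<dots> \<le> L * s - 1"
      using mult_left_mono[of "1 / (L - 1)" 1 "L * s - 1"] False L by simp
    finally have m: "min (L * s / 2) ?m = ?m"
      by (intro *) simp
    have pos: "(L * s - 1) / (2 * (L - 1)) > 0" using False L by simp
    have m1: "\<not> ?m \<le> 1/2" using pos by linarith
    have m2: "2 * ?m - 1 = (L * s - 1) / (L - 1)" using L by (simp add: field_simps)
    have Lw: "L - 1 = real (length w)" by (simp add: L_def)
    let ?s' = "(L * s - 1) / (L - 1)"
    have s'01: "?s' \<in> {0..1}"
      using False L s mult_left_mono[of s 1 L] by (auto simp: divide_simps)
    have s': "real (length w) * ?s' = L * s - 1" using L unfolding Lw[symmetric] by simp
    obtain j where j: "j < length w" "real j \<le> real (length w) * ?s'" "real (length w) * ?s' \<le> real j + 1"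
      using word_path_cases[OF w s'01] by blast
    have "word_path w ?s' = letter (w ! j) (L * s - 1 - j)"
      using word_path_nth[OF j] unfolding s' .
    moreover have "word_path (l # w) s = letter ((l # w) ! Suc j) (L * s - real (Suc j))"
      using word_path_nth[of "Suc j" "l # w" s] j unfolding s' len by simp
    ultimately show ?thesis
      unfolding m using m1 m2 by (simp add: jn_def algebra_simps)
  qed
qed

lemma word_path_Cons_homotopic:
  assumes b: "Base \<in> topspace X" and l: "continuous_map I01 X (letter l)"
    and w: "continuous_map I01 X (word_path w)"
  shows "loop_homotopic X Base (word_path (l # w)) (jn (letter l) (word_path w))"
proof (cases "w = []")
  case True
  have "loop_homotopic X Base (jn (letter l) (word_path w)) (letter l)"
    using loop_homotopic_jn_const_right[OF l] True by (simp add: word_path_def[abs_def])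
  also have "loop_homotopic X Base (letter l) (word_path (l # w))"
    using l True by (intro loop_homotopic_eqI) (auto simp: word_path_single)
  finally show ?thesis by (rule loop_homotopic_sym)
next
  case False
  define L where "L = real (length w) + 1"
  have L: "L \<ge> 2" using False by (cases w) (auto simp: L_def)
  let ?f = "\<lambda>s. min (L * s / 2) (1/2 + (L * s - 1) / (2 * (L - 1)))"
  have f1: "?f 1 = 1" "?f 0 = 0" using L by (auto simp: min_def divide_simps)
  have jc: "continuous_map I01 X (jn (letter l) (word_path w))"
    using l w by (intro continuous_map_jn) auto
  have f: "?f \<in> {0..1} \<rightarrow> {0..1}"
  proof
    fix s :: real assume s: "s \<in> {0..1}"
    have "0 \<le> L * s" using s L by simp
    moreover have "L * s \<le> L * 1" using s L by (intro mult_left_mono) auto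
    ultimately show "?f s \<in> {0..1}"
      using L by (auto simp: min_le_iff_disj divide_simps)
  qed
  have "loop_homotopic X Base (\<lambda>s. jn (letter l) (word_path w) (?f s)) (\<lambda>s. jn (letter l) (word_path w) s)"
    using jc L f f1 by (intro loop_homotopic_reparam continuous_intros) auto
  moreover from loop_homotopicD[OF this]
  have "loop_homotopic X Base (\<lambda>s. jn (letter l) (word_path w) (?f s)) (word_path (l # w))"
    by (intro loop_homotopic_eqI) (auto simp: word_path_Cons[OF False] L_def)
  ultimately show ?thesis
    using loop_homotopic_sym loop_homotopic_trans by fastforce
qed

text \<open>Continuity is read off the homotopy in \<open>word_path_Cons_homotopic\<close>, of which
  the path is one end, instead of being pasted together from \<open>length w\<close> arcs.\<close>

lemma continuous_map_word_path:
  assumes b: "Base \<in> topspace X" and w: "\<And>l. l \<in> set w \<Longrightarrow> continuous_map I01 X (letter l)"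
  shows "continuous_map I01 X (word_path w)"
  using w
proof (induction w)
  case Nil
  then show ?case using b by (simp add: word_path_def[abs_def])
next
  case (Cons l w)
  then show ?case using loop_homotopicD(1)[OF word_path_Cons_homotopic[OF b, of l w]] by simp
qed

lemma word_path_append_homotopic:
  assumes b: "Base \<in> topspace X" and w: "\<And>l. l \<in> set (u @ v) \<Longrightarrow> continuous_map I01 X (letter l)"
  shows "loop_homotopic X Base (word_path (u @ v)) (jn (word_path u) (word_path v))"
  using w
proof (induction u)
  case Nil
  then have "continuous_map I01 X (word_path v)" by (intro continuous_map_word_path[OF b]) auto
  from loop_homotopic_jn_const_left[OF this] show ?case
    by (simp add: loop_homotopic_sym word_path_def[of "[]", abs_def])
next
  case (Cons l u)
  have c: "continuous_map I01 X (letter l)" "continuous_map I01 X (word_path u)"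
      "continuous_map I01 X (word_path v)" "continuous_map I01 X (word_path (u @ v))"
    using Cons.prems by (auto intro!: continuous_map_word_path[OF b])
  have "loop_homotopic X Base (word_path (l # u @ v)) (jn (letter l) (word_path (u @ v)))"
    using c by (intro word_path_Cons_homotopic[OF b])
  also have "loop_homotopic X Base \<dots> (jn (letter l) (jn (word_path u) (word_path v)))"
    by (intro loop_homotopic_jn loop_homotopic_eqI c Cons.IH Cons.prems) auto
  also have "loop_homotopic X Base \<dots> (jn (jn (letter l) (word_path u)) (word_path v))"
    using c by (intro loop_homotopic_sym[OF loop_homotopic_jn_assoc]) auto
  also have "loop_homotopic X Base \<dots> (jn (word_path (l # u)) (word_path v))"
    using c by (intro loop_homotopic_jn loop_homotopic_sym[OF word_path_Cons_homotopic[OF b]])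
      (auto intro: loop_homotopic_eqI)
  finally show ?case by simp
qed

text \<open>Joining respects homotopy, so relations that hold letter by letter carry over to a whole
  relator; this is the topological form of substitution into a word.\<close>

lemma word_path_subst_homotopic:
  assumes b: "Base \<in> topspace X"
    and \<sigma>: "\<And>l. l \<in> set w \<Longrightarrow> loop_homotopic X Base (letter l) (word_path (\<sigma> l))"
    and c: "\<And>l m. l \<in> set w \<Longrightarrow> m \<in> set (\<sigma> l) \<Longrightarrow> continuous_map I01 X (letter m)"
  shows "loop_homotopic X Base (word_path w) (word_path (concat (map \<sigma> w)))"
  using \<sigma> c
proof (induction w)
  case Nil
  then show ?case using b by (auto intro!: loop_homotopic_eqI simp: word_path_def[abs_def])
next
  case (Cons l w)
  have "continuous_map I01 X (word_path w)"
    using loop_homotopicD(1)[OF Cons.prems(1)] by (intro continuous_map_word_path[OF b]) simp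
  then have "loop_homotopic X Base (word_path (l # w)) (jn (letter l) (word_path w))"
    using loop_homotopicD(1)[OF Cons.prems(1)[of l]] by (intro word_path_Cons_homotopic[OF b]) auto
  also have "loop_homotopic X Base \<dots> (jn (word_path (\<sigma> l)) (word_path (concat (map \<sigma> w))))"
    by (intro loop_homotopic_jn Cons.IH Cons.prems) auto
  also have "loop_homotopic X Base \<dots> (word_path (\<sigma> l @ concat (map \<sigma> w)))"
  proof (intro loop_homotopic_sym[OF word_path_append_homotopic[OF b]])
    fix m assume "m \<in> set (\<sigma> l @ concat (map \<sigma> w))"
    then obtain l' where "l' \<in> set (l # w)" "m \<in> set (\<sigma> l')"
      by (cases "m \<in> set (\<sigma> l)") (simp del: split_paired_Ex split_paired_All, metis, fastforce)
    then show "continuous_map I01 X (letter m)" by (rule Cons.prems(2))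
  qed
  finally show ?case by simp
qed

text \<open>An equality of points and not just a homotopy: all arcs have equal length, so running w
  backwards carries arc j to arc \<open>length w - Suc j\<close> with its letter inverted.\<close>

lemma word_path_inv_word:
  assumes s: "s \<in> {0..1}"
  shows "word_path (inv_word w) s = word_path w (1 - s)"
proof (cases "w = []")
  case True
  then show ?thesis by (simp add: inv_word_def)
next
  case False
  have len: "length (inv_word w) = length w" by (simp add: inv_word_def)
  obtain j where j: "j < length w" "real j \<le> real (length w) * s" "real (length w) * s \<le> real j + 1"
    using word_path_cases[OF False s] by blast
  have 1: "word_path (inv_word w) s = letter (inv_word w ! j) (length w * s - j)"
    using word_path_nth[of j "inv_word w" s] j by (simp add: len)
  let ?j = "length w - Suc j"
  have rj: "real ?j = real (length w) - real j - 1" using j by (simp add: of_nat_diff)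
  have 2: "word_path w (1 - s) = letter (w ! ?j) (length w * (1 - s) - ?j)"
    using j by (intro word_path_nth) (auto simp: rj algebra_simps)
  have 3: "inv_word w ! j = (fst (w ! ?j), \<not> snd (w ! ?j))"
    using j by (simp add: inv_word_def rev_nth case_prod_unfold)
  show ?thesis
    unfolding 1 2 3 letter_inverse rj by (simp add: algebra_simps)
qed

section \<open>Presentation complexes\<close>

abbreviation disc_top :: "(real \<times> real) topology" where
  "disc_top \<equiv> top_of_set (cball 0 1)"

section \<open>Products with a discrete index set: families of discs treated at once\<close>

lemma openin_prod_discrete:
  "openin (prod_topology (discrete_topology M) X) U \<longleftrightarrow>
     U \<subseteq> M \<times> topspace X \<and> (\<forall>m\<in>M. openin X {x \<in> topspace X. (m, x) \<in> U})"
proof (intro iffI conjI ballI)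
  assume U: "openin (prod_topology (discrete_topology M) X) U"
  then show "U \<subseteq> M \<times> topspace X" using openin_subset by fastforce
  fix m assume "m \<in> M"
  then have "continuous_map X (prod_topology (discrete_topology M) X) (\<lambda>x. (m, x))"
    by (intro continuous_map_pairedI) auto
  then show "openin X {x \<in> topspace X. (m, x) \<in> U}" using U by (auto simp: continuous_map)
next
  assume U: "U \<subseteq> M \<times> topspace X \<and> (\<forall>m\<in>M. openin X {x \<in> topspace X. (m, x) \<in> U})"
  show "openin (prod_topology (discrete_topology M) X) U"
    unfolding openin_prod_topology_alt
  proof (intro allI impI)
    fix m x assume mx: "(m, x) \<in> U"
    then show "\<exists>A B. openin (discrete_topology M) A \<and> openin X B \<and> m \<in> A \<and> x \<in> B \<and> A \<times> B \<subseteq> U"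
      using U by (intro exI[of _ "{m}"] exI[of _ "{x \<in> topspace X. (m, x) \<in> U}"]) auto
  qed
qed

text \<open>The set J may meet each copy of X differently, as arcs of different lengths do. In each
  copy a relatively open set extends to an open \<open>T m\<close>, and \<open>Sigma M T\<close> is
  open because the index set is discrete.\<close>

lemma continuous_map_subtopology_prod_discrete:
  assumes "\<And>m. m \<in> M \<Longrightarrow> continuous_map (subtopology X {x. (m, x) \<in> J}) Y (\<lambda>x. f (m, x))"
  shows "continuous_map (subtopology (prod_topology (discrete_topology M) X) J) Y f"
  unfolding continuous_map
proof (intro conjI allI impI)
  show "f ` topspace (subtopology (prod_topology (discrete_topology M) X) J) \<subseteq> topspace Y"
  proof clarify
    fix m x assume "(m, x) \<in> topspace (subtopology (prod_topology (discrete_topology M) X) J)"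
    then show "f (m, x) \<in> topspace Y"
      using continuous_map_image_subset_topspace[OF assms, of m] by auto
  qed
  fix U assume U: "openin Y U"
  have "\<exists>T. openin X T \<and> {x \<in> topspace X. (m, x) \<in> J \<and> f (m, x) \<in> U} = T \<inter> {x. (m, x) \<in> J}"
    if "m \<in> M" for m
  proof -
    have "openin (subtopology X {x. (m, x) \<in> J}) {x \<in> topspace (subtopology X {x. (m, x) \<in> J}). f (m, x) \<in> U}"
      using assms[OF that] U unfolding continuous_map by blast
    then show ?thesis by (simp add: openin_subtopology conj_assoc)
  qed
  then have "\<forall>m\<in>M. \<exists>T. openin X T \<and> {x \<in> topspace X. (m, x) \<in> J \<and> f (m, x) \<in> U} = T \<inter> {x. (m, x) \<in> J}"
    by blast
  from bchoice[OF this] obtain T where T: "\<And>m. m \<in> M \<Longrightarrow> openin X (T m)"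
    "\<And>m. m \<in> M \<Longrightarrow> {x \<in> topspace X. (m, x) \<in> J \<and> f (m, x) \<in> U} = T m \<inter> {x. (m, x) \<in> J}"
    by blast
  have "openin (prod_topology (discrete_topology M) X) (Sigma M T)"
    unfolding openin_prod_discrete
  proof (intro conjI ballI)
    show "Sigma M T \<subseteq> M \<times> topspace X" using T(1) openin_subset by fastforce
    fix m assume m: "m \<in> M"
    then have "{x \<in> topspace X. (m, x) \<in> Sigma M T} = T m" using T(1) openin_subset by fastforce
    then show "openin X {x \<in> topspace X. (m, x) \<in> Sigma M T}" using T(1) m by simp
  qed
  moreover have "{x \<in> topspace (subtopology (prod_topology (discrete_topology M) X) J). f x \<in> U} =
      Sigma M T \<inter> J"
    using T(2) by (auto simp: set_eq_iff)
  ultimately show "openin (subtopology (prod_topology (discrete_topology M) X) J)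
      {x \<in> topspace (subtopology (prod_topology (discrete_topology M) X) J). f x \<in> U}"
    by (auto simp: openin_subtopology)
qed

lemma continuous_map_prod_discrete:
  assumes "\<And>m. m \<in> M \<Longrightarrow> continuous_map X Y (\<lambda>x. f (m, x))"
  shows "continuous_map (prod_topology (discrete_topology M) X) Y f"
  using continuous_map_subtopology_prod_discrete[of M X UNIV Y f] assms by simp

lemma continuous_map_prod_prod_discrete:
  assumes "\<And>m. m \<in> M \<Longrightarrow> continuous_map (prod_topology T X) Y (\<lambda>(t, x). f (t, (m, x)))"
  shows "continuous_map (prod_topology T (prod_topology (discrete_topology M) X)) Y f"
proof -
  have "continuous_map (prod_topology (discrete_topology M) (prod_topology T X)) Y
      (\<lambda>(m, (t, x)). f (t, (m, x)))"
    by (intro continuous_map_prod_discrete) (use assms in \<open>simp add: case_prod_unfold\<close>)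
  moreover have "continuous_map (prod_topology T (prod_topology (discrete_topology M) X))
      (prod_topology (discrete_topology M) (prod_topology T X)) (\<lambda>p. (fst (snd p), (fst p, snd (snd p))))"
    by (intro continuous_map_pairedI continuous_map_fst continuous_map_snd_of
        continuous_map_compose[OF continuous_map_snd continuous_map_fst, unfolded o_def]
        continuous_map_compose[OF continuous_map_snd continuous_map_snd, unfolded o_def])
  ultimately have "continuous_map (prod_topology T (prod_topology (discrete_topology M) X)) Y
      ((\<lambda>(m, (t, x)). f (t, (m, x))) \<circ> (\<lambda>p. (fst (snd p), (fst p, snd (snd p)))))"
    by (rule continuous_map_compose[rotated])
  then show ?thesis by (simp add: o_def)
qed

section \<open>Parametrisation of the boundary circle\<close>

definition circ :: "real \<Rightarrow> real \<times> real" where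
  "circ s = (cos (2 * pi * s), sin (2 * pi * s))"

lemma norm_circ [simp]: "norm (circ s) = 1"
  by (simp add: circ_def norm_prod_def)

lemma circ_1 [simp]: "circ 1 = circ 0"
  by (simp add: circ_def)

lemma continuous_on_circ: "continuous_on A circ"
  unfolding circ_def by (intro continuous_intros)

lemma inj_on_circ: "inj_on circ {0..<1}"
proof (rule inj_onI)
  fix s t :: real assume st: "s \<in> {0..<1}" "t \<in> {0..<1}" "circ s = circ t"
  then obtain n :: int where "2 * pi * s = 2 * pi * t + 2 * pi * n"
    using sin_cos_eq_iff[of "2 * pi * s" "2 * pi * t"] by (auto simp: circ_def)
  then have "2 * pi * s = 2 * pi * (t + n)" by (simp add: distrib_left)
  then have "s = t + n" by simp
  moreover then have "n = 0" using st by auto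
  ultimately show "s = t" by simp
qed

lemma circ_param:
  assumes "norm z = 1"
  shows "circ_param z \<in> {0..<1}" "circ (circ_param z) = z"
proof -
  obtain x y where z: "z = (x, y)" by (cases z)
  have "x\<^sup>2 + y\<^sup>2 = 1" using assms by (simp add: z norm_prod_def)
  then obtain t where t: "0 \<le> t" "t < 2 * pi" "x = cos t" "y = sin t" by (rule sincos_total_2pi)
  have "0 \<le> t / (2 * pi) \<and> t / (2 * pi) < 1 \<and> z = (cos (2 * pi * (t / (2 * pi))), sin (2 * pi * (t / (2 * pi))))"
    using t z by simp
  from someI[of "\<lambda>s. 0 \<le> s \<and> s < 1 \<and> z = (cos (2 * pi * s), sin (2 * pi * s))", OF this]
  show "circ_param z \<in> {0..<1}" "circ (circ_param z) = z"
    by (auto simp: circ_param_def circ_def)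
qed

lemma circ_param_circ: "s \<in> {0..<1} \<Longrightarrow> circ_param (circ s) = s"
  using circ_param[of "circ s"] inj_onD[OF inj_on_circ] by simp

lemma sphere_eq_circ: "sphere 0 1 = circ ` {0..1}"
proof (intro equalityI subsetI)
  fix z :: "real \<times> real" assume "z \<in> sphere 0 1"
  then have "norm z = 1" by simp
  from circ_param[OF this] show "z \<in> circ ` {0..1}"
    by (metis atLeastAtMost_iff atLeastLessThan_iff image_eqI less_eq_real_def)
qed auto

text \<open>\<open>circ_param\<close> jumps where the circle closes up, so continuity on the circle
  or an arc of it is checked after composition with \<open>circ\<close> and pushed down along this
  quotient map from a compact to a Hausdorff space.\<close>

lemma quotient_map_circ: "quotient_map (top_of_set {a..b}) (top_of_set (circ ` {a..b})) circ"
  by (rule continuous_imp_quotient_map) (auto simp: continuous_on_circ compact_space_subtopology Hausdorff_space_subtopology)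

definition dpt :: "('g \<Rightarrow> ('g \<times> bool) list) \<Rightarrow> 'g \<Rightarrow> real \<times> real \<Rightarrow> 'g pt" where
  "dpt R i z = (if norm z = 1 then word_path (R i) (circ_param z) else Disc i z)"

lemma dpt_circ:
  assumes "s \<in> {0..1}" shows "dpt R i (circ s) = word_path (R i) s"
proof (cases "s = 1")
  case True
  then show ?thesis using circ_param_circ[of 0] by (simp add: dpt_def)
next
  case False
  then show ?thesis using assms circ_param_circ[of s] by (simp add: dpt_def)
qed

text \<open>The complex with one vertex, edges G and discs I attached along the words R; its points are
  normal forms, each in exactly one open cell.\<close>
definition cells :: "'g set \<Rightarrow> 'g set \<Rightarrow> 'g pt set" where
  "cells G I = {Base} \<union> {Edge g t | g t. g \<in> G \<and> 0 < t \<and> t < 1} \<union> {Disc i z | i z. i \<in> I \<and> norm z < 1}"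

definition cpx :: "'g set \<Rightarrow> 'g set \<Rightarrow> ('g \<Rightarrow> ('g \<times> bool) list) \<Rightarrow> 'g pt topology" where
  "cpx G I R = topology (\<lambda>U. U \<subseteq> cells G I \<and>
     (\<forall>g\<in>G. openin I01 {t \<in> {0..1}. ept g t \<in> U}) \<and>
     (\<forall>i\<in>I. openin disc_top {z \<in> cball 0 1. dpt R i z \<in> U}))"

definition words_in :: "'g set \<Rightarrow> 'g set \<Rightarrow> ('g \<Rightarrow> ('g \<times> bool) list) \<Rightarrow> bool" where
  "words_in G I R \<longleftrightarrow> (\<forall>i\<in>I. fst ` set (R i) \<subseteq> G)"

lemma openin_cpx:
  "openin (cpx G I R) U \<longleftrightarrow> U \<subseteq> cells G I \<and>
     (\<forall>g\<in>G. openin I01 {t \<in> {0..1}. ept g t \<in> U}) \<and>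
     (\<forall>i\<in>I. openin disc_top {z \<in> cball 0 1. dpt R i z \<in> U})"
proof -
  have "istopology (\<lambda>U. U \<subseteq> cells G I \<and>
     (\<forall>g\<in>G. openin I01 {t \<in> {0..1}. ept g t \<in> U}) \<and>
     (\<forall>i\<in>I. openin disc_top {z \<in> cball 0 1. dpt R i z \<in> U}))" (is "istopology ?P")
    unfolding istopology_def
  proof (rule conjI; intro allI impI)
    fix U V assume UV: "?P U" "?P V"
    have eq: "{t \<in> {0..1}. ept g t \<in> U \<inter> V} = {t \<in> {0..1}. ept g t \<in> U} \<inter> {t \<in> {0..1}. ept g t \<in> V}"
      "{z \<in> cball 0 1. dpt R g z \<in> U \<inter> V} = {z \<in> cball 0 1. dpt R g z \<in> U} \<inter> {z \<in> cball 0 1. dpt R g z \<in> V}" for g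
      by auto
    show "?P (U \<inter> V)"
      unfolding eq using UV by (intro conjI ballI openin_Int) auto
  next
    fix K assume K: "\<forall>U\<in>K. ?P U"
    have eq: "{t \<in> {0..1}. ept g t \<in> \<Union>K} = \<Union>((\<lambda>U. {t \<in> {0..1}. ept g t \<in> U}) ` K)"
      "{z \<in> cball 0 1. dpt R g z \<in> \<Union>K} = \<Union>((\<lambda>U. {z \<in> cball 0 1. dpt R g z \<in> U}) ` K)" for g
      by auto
    show "?P (\<Union>K)"
      unfolding eq using K by (intro conjI ballI openin_Union) auto
  qed
  then show ?thesis by (simp add: cpx_def)
qed

lemma Base_in_cells [simp]: "Base \<in> cells G I"
  by (simp add: cells_def)

lemma ept_in_cells: "g \<in> G \<Longrightarrow> t \<in> {0..1} \<Longrightarrow> ept g t \<in> cells G I"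
  by (auto simp: ept_def cells_def)

lemma Disc_in_cells: "i \<in> I \<Longrightarrow> norm z < 1 \<Longrightarrow> Disc i z \<in> cells G I"
  unfolding cells_def by blast

lemma letter_in_cells: "fst l \<in> G \<Longrightarrow> t \<in> {0..1} \<Longrightarrow> letter l t \<in> cells G I"
  by (auto simp: letter_def intro!: ept_in_cells)

lemma word_path_in_cells:
  assumes "fst ` set w \<subseteq> G" "s \<in> {0..1}"
  shows "word_path w s \<in> cells G I"
proof (cases "w = []")
  case False
  obtain j where j: "j < length w" "real j \<le> real (length w) * s" "real (length w) * s \<le> real j + 1"
    using word_path_cases[OF False assms(2)] by blast
  show ?thesis
    unfolding word_path_nth[OF j] using j assms by (intro letter_in_cells) auto
qed simp

lemma dpt_in_cells:
  assumes "words_in G I R" "i \<in> I" "norm z \<le> 1"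
  shows "dpt R i z \<in> cells G I"
proof (cases "norm z = 1")
  case True
  then show ?thesis
    using assms circ_param(1)[OF True] by (auto simp: dpt_def words_in_def intro!: word_path_in_cells)
next
  case False
  then have "norm z < 1" using assms by simp
  then show ?thesis using False assms by (simp add: dpt_def Disc_in_cells)
qed

lemma topspace_cpx:
  assumes "words_in G I R"
  shows "topspace (cpx G I R) = cells G I"
proof -
  have "{t \<in> {0..1}. ept g t \<in> cells G I} = {0..1}" if "g \<in> G" for g
    using ept_in_cells[OF that] by auto
  moreover have "{z \<in> cball 0 1. dpt R i z \<in> cells G I} = cball 0 1" if "i \<in> I" for i
    using dpt_in_cells[OF assms that] by auto
  ultimately have "openin (cpx G I R) (cells G I)"
    by (auto simp: openin_cpx)
  then show ?thesis
    by (metis openin_cpx openin_subset openin_topspace subset_antisym)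
qed

lemma continuous_map_ept:
  assumes "words_in G I R" "g \<in> G"
  shows "continuous_map I01 (cpx G I R) (ept g)"
  unfolding continuous_map topspace_cpx[OF assms(1)] openin_cpx using assms(2)
  by (auto intro!: ept_in_cells)

lemma continuous_map_letter:
  assumes "words_in G I R" "fst l \<in> G"
  shows "continuous_map I01 (cpx G I R) (letter l)"
proof (cases "snd l")
  case True
  then show ?thesis
    using continuous_map_ept[OF assms] by (simp add: letter_def[abs_def])
next
  case False
  have "continuous_map I01 I01 (\<lambda>u. 1 - u)"
    by (auto intro!: continuous_intros)
  from continuous_map_compose[OF this continuous_map_ept[OF assms]]
  show ?thesis using False by (simp add: letter_def[abs_def] o_def)
qed

lemma continuous_map_dpt:
  assumes "words_in G I R" "i \<in> I"
  shows "continuous_map disc_top (cpx G I R) (dpt R i)"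
  unfolding continuous_map topspace_cpx[OF assms(1)] openin_cpx using assms(2)
  by (auto intro!: dpt_in_cells[OF assms])

lemma continuous_map_word_path_cpx:
  assumes "words_in G I R" "fst ` set w \<subseteq> G"
  shows "continuous_map I01 (cpx G I R) (word_path w)"
  using assms by (intro continuous_map_word_path continuous_map_letter) (auto simp: topspace_cpx)

lemma continuous_map_from_cpx:
  assumes R: "words_in G I R" and B: "f Base \<in> topspace W"
    and e: "\<And>g. g \<in> G \<Longrightarrow> continuous_map I01 W (\<lambda>t. f (ept g t))"
    and d: "\<And>i. i \<in> I \<Longrightarrow> continuous_map disc_top W (\<lambda>z. f (dpt R i z))"
  shows "continuous_map (cpx G I R) W f"
  unfolding continuous_map topspace_cpx[OF R]
proof (intro conjI allI impI)
  show "f ` cells G I \<subseteq> topspace W"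
  proof
    fix y assume "y \<in> f ` cells G I"
    then consider "y = f Base" | g t where "g \<in> G" "0 < t" "t < 1" "y = f (Edge g t)"
      | i z where "i \<in> I" "norm z < 1" "y = f (Disc i z)"
      by (auto simp: cells_def)
    then show "y \<in> topspace W"
    proof cases
      case 2
      then have "y = f (ept g t)" by (simp add: ept_def)
      then show ?thesis using continuous_map_image_subset_topspace[OF e[OF 2(1)]] 2 by auto
    next
      case 3
      then have "y = f (dpt R i z)" by (simp add: dpt_def)
      then show ?thesis using continuous_map_image_subset_topspace[OF d[OF 3(1)]] 3 by auto
    qed (use B in auto)
  qed
  fix U assume U: "openin W U"
  show "openin (cpx G I R) {x \<in> cells G I. f x \<in> U}"
    unfolding openin_cpx
  proof (intro conjI ballI)
    fix g assume g: "g \<in> G"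
    then have "{t \<in> {0..1}. ept g t \<in> {x \<in> cells G I. f x \<in> U}} = {t \<in> topspace I01. f (ept g t) \<in> U}"
      using ept_in_cells[OF g] by auto
    then show "openin I01 {t \<in> {0..1}. ept g t \<in> {x \<in> cells G I. f x \<in> U}}"
      using e[OF g] U by (simp add: continuous_map)
  next
    fix i assume i: "i \<in> I"
    then have "{z \<in> cball 0 1. dpt R i z \<in> {x \<in> cells G I. f x \<in> U}} = {z \<in> topspace disc_top. f (dpt R i z) \<in> U}"
      using dpt_in_cells[OF R i] by auto
    then show "openin disc_top {z \<in> cball 0 1. dpt R i z \<in> {x \<in> cells G I. f x \<in> U}}"
      using d[OF i] U by (simp add: continuous_map)
  qed auto
qed

lemma cells_mono: "G \<subseteq> G' \<Longrightarrow> I \<subseteq> I' \<Longrightarrow> cells G I \<subseteq> cells G' I'"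
  by (auto simp: cells_def)

lemma continuous_map_cpx_inclusion:
  assumes "words_in G' I' R" "words_in G I R" "G \<subseteq> G'" "I \<subseteq> I'"
  shows "continuous_map (cpx G I R) (cpx G' I' R) id"
  using assms
  by (intro continuous_map_from_cpx)
     (auto simp: topspace_cpx intro: continuous_map_ept continuous_map_dpt[of _ _ R, unfolded eta_contract_eq])

text \<open>Off the bounding circle \<open>dpt R m z\<close> is \<open>Disc m z\<close>, hence
  injective and outside the old cells; on the circle it lies in the one-skeleton, which belongs to
  the old complex because the words use G only.\<close>

lemma pushout_attach_discs:
  assumes R: "words_in G (I \<union> M) R" and IM: "I \<inter> M = {}"
  shows "pushout (cpx G I R) (prod_topology (discrete_topology M) disc_top) (M \<times> sphere 0 1)
           (\<lambda>(m,z). dpt R m z) (cpx G (I \<union> M) R) id (\<lambda>(m,z). dpt R m z)"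
proof -
  have R': "words_in G I R" "words_in G M R" using R by (auto simp: words_in_def)
  have top: "topspace (cpx G (I \<union> M) R) = cells G (I \<union> M)" "topspace (cpx G I R) = cells G I"
    using R R' by (simp_all add: topspace_cpx)
  have bd: "dpt R m z \<in> cells G {}" if "m \<in> M" "norm z = 1" for m z
    using that R' circ_param(1)[OF that(2)] by (auto simp: dpt_def words_in_def intro!: word_path_in_cells)
  have cell: "dpt R m z = Disc m z" if "norm z \<noteq> 1" for m z using that by (simp add: dpt_def)
  show ?thesis
    unfolding pushout_def top
  proof (intro conjI ballI allI impI)
    show "continuous_map (cpx G I R) (cpx G (I \<union> M) R) id"
      using R R' by (intro continuous_map_cpx_inclusion) auto
    show "continuous_map (prod_topology (discrete_topology M) disc_top) (cpx G (I \<union> M) R) (\<lambda>(m,z). dpt R m z)"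
      using R by (intro continuous_map_prod_discrete) (auto intro!: continuous_map_dpt)
    show "inj_on (\<lambda>(m,z). dpt R m z) (topspace (prod_topology (discrete_topology M) disc_top) - M \<times> sphere 0 1)"
      by (auto simp: inj_on_def cell)
    show "id ` cells G I \<inter> (\<lambda>(m,z). dpt R m z) ` (topspace (prod_topology (discrete_topology M) disc_top) - M \<times> sphere 0 1) = {}"
    proof -
      have "dpt R m z \<notin> cells G I" if "m \<in> M" "norm z \<noteq> 1" for m z
        using that IM by (auto simp: cell cells_def)
      then show ?thesis by fastforce
    qed
    show "cells G (I \<union> M) = id ` cells G I \<union> (\<lambda>(m,z). dpt R m z) ` topspace (prod_topology (discrete_topology M) disc_top)"
    proof (intro equalityI subsetI)
      fix x assume "x \<in> cells G (I \<union> M)"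
      then consider "x \<in> cells G I" | m z where "m \<in> M" "norm z < 1" "x = Disc m z"
        unfolding cells_def by blast
      then show "x \<in> id ` cells G I \<union> (\<lambda>(m,z). dpt R m z) ` topspace (prod_topology (discrete_topology M) disc_top)"
      proof cases
        case 2
        then have "(m, z) \<in> topspace (prod_topology (discrete_topology M) disc_top)"
          "x = (case (m, z) of (m, z) \<Rightarrow> dpt R m z)"
          using cell[of z m] by auto
        then show ?thesis by (intro UnI2) (rule image_eqI)
      qed auto
    next
      fix x assume "x \<in> id ` cells G I \<union> (\<lambda>(m,z). dpt R m z) ` topspace (prod_topology (discrete_topology M) disc_top)"
      then show "x \<in> cells G (I \<union> M)"
        using cells_mono[of G G I "I \<union> M"] dpt_in_cells[OF R] by auto
    qed
    fix U assume U: "U \<subseteq> cells G (I \<union> M) \<and> openin (cpx G I R) {x \<in> cells G I. id x \<in> U} \<and>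
       openin (prod_topology (discrete_topology M) disc_top)
         {e \<in> topspace (prod_topology (discrete_topology M) disc_top). (case e of (m,z) \<Rightarrow> dpt R m z) \<in> U}"
    then have U1: "\<forall>g\<in>G. openin I01 {t \<in> {0..1}. ept g t \<in> {x \<in> cells G I. id x \<in> U}}"
      "\<forall>i\<in>I. openin disc_top {z \<in> cball 0 1. dpt R i z \<in> {x \<in> cells G I. id x \<in> U}}"
      unfolding openin_cpx by blast+
    show "openin (cpx G (I \<union> M) R) U"
      unfolding openin_cpx
    proof (intro conjI ballI)
      fix g assume g: "g \<in> G"
      then have eq: "{t \<in> {0..1}. ept g t \<in> {x \<in> cells G I. id x \<in> U}} = {t \<in> {0..1}. ept g t \<in> U}"
        using ept_in_cells[OF g] by auto
      then show "openin I01 {t \<in> {0..1}. ept g t \<in> U}" using bspec[OF U1(1) g] by (simp only: eq)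
    next
      fix i assume i: "i \<in> I \<union> M"
      show "openin disc_top {z \<in> cball 0 1. dpt R i z \<in> U}"
      proof (cases "i \<in> I")
        case True
        then have eq: "{z \<in> cball 0 1. dpt R i z \<in> {x \<in> cells G I. id x \<in> U}} = {z \<in> cball 0 1. dpt R i z \<in> U}"
          using dpt_in_cells[OF R'(1)] by auto
        then show ?thesis using bspec[OF U1(2) True] by (simp only: eq)
      next
        case False
        then show ?thesis using U i unfolding openin_prod_discrete by (auto cong: conj_cong)
      qed
    qed (use U in auto)
  qed (use bd cells_mono[of G G "{}" I] in auto)
qed

section \<open>Free faces\<close>

text \<open>In a convex C a retraction onto J is already a deformation retraction, along segments,
  and these are constant where \<open>r m\<close> is the identity. The set C is left general to
  cover both the disc and the cylinder over it.\<close>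

lemma pushout_deformation_convex:
  fixes C :: "'c::real_normed_vector set"
  defines "E \<equiv> \<lambda>M. prod_topology (discrete_topology M) (top_of_set C)"
  assumes po: "pushout X (E M) S \<Phi> Z i j" and C: "convex C"
    and r: "\<And>m. m \<in> M \<Longrightarrow> continuous_on C (r m)"
      "\<And>m z. m \<in> M \<Longrightarrow> z \<in> C \<Longrightarrow> (m, r m z) \<in> J"
      "\<And>m z. (m, z) \<in> J \<Longrightarrow> r m z = z"
    and SJ: "S \<subseteq> J" "J \<subseteq> M \<times> C"
    and i': "continuous_map X Z' i'"
    and \<rho>: "continuous_map (subtopology (E M) J) Z' \<rho>" "\<And>e. e \<in> S \<Longrightarrow> \<rho> e = i' (\<Phi> e)"
    and F: "continuous_map Z' Z F" "\<And>x. x \<in> topspace X \<Longrightarrow> F (i' x) = i x" "\<And>e. e \<in> J \<Longrightarrow> F (\<rho> e) = j e"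
    and Z': "topspace Z' \<subseteq> i' ` topspace X \<union> \<rho> ` J"
  shows "Z homotopy_equivalent_space Z'"
proof (rule pushout_deformation[OF po _ _ _ _ _ SJ(1) _ i' \<rho> F Z'])
  let ?h = "\<lambda>(t::real, m, z). (m, (1 - t) *\<^sub>R z + t *\<^sub>R r m z)"
  have top: "topspace (E M) = M \<times> C" by (simp add: E_def)
  have rC: "r m z \<in> C" if "m \<in> M" "z \<in> C" for m z
    using r(2)[OF that] SJ by auto
  show "continuous_map (prod_topology I01 (E M)) (E M) ?h"
    unfolding E_def
  proof (intro continuous_map_prod_prod_discrete)
    fix m assume m: "m \<in> M"
    have "continuous_on ({0..1} \<times> C) (\<lambda>p. (1 - fst p) *\<^sub>R snd p + fst p *\<^sub>R r m (snd p))"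
      using r(1)[OF m] by (intro continuous_intros continuous_on_compose2[OF r(1)[OF m]]) auto
    moreover have "(1 - fst p) *\<^sub>R snd p + fst p *\<^sub>R r m (snd p) \<in> C" if "p \<in> {0..1} \<times> C" for p
      using that rC[OF m] by (intro convexD_alt[OF C]) auto
    ultimately have "continuous_map (prod_topology I01 (top_of_set C)) (top_of_set C)
        (\<lambda>p. (1 - fst p) *\<^sub>R snd p + fst p *\<^sub>R r m (snd p))"
      by (auto simp: prod_topology_subtopology_eu)
    then have "continuous_map (prod_topology I01 (top_of_set C)) (prod_topology (discrete_topology M) (top_of_set C))
        (\<lambda>p. (m, (1 - fst p) *\<^sub>R snd p + fst p *\<^sub>R r m (snd p)))"
      using m by (intro continuous_map_pairedI) auto
    then show "continuous_map (prod_topology I01 (top_of_set C)) (prod_topology (discrete_topology M) (top_of_set C))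
        (\<lambda>(t, z). ?h (t, m, z))"
      by (simp add: case_prod_unfold)
  qed
  show "J \<subseteq> topspace (E M)" using SJ top by simp
  show "?h (1, e) \<in> J" if "e \<in> topspace (E M)" for e
    using that r(2) by (auto simp: top)
  show "?h (1, e) = e" if "e \<in> J" for e
    using that r(3) by (cases e) auto
  show "?h (t, e) = e" if "t \<in> {0..1}" "e \<in> S" for t e
    using that r(3) SJ by (cases e) (auto simp: algebra_simps)
qed auto

text \<open>The strict bound on \<open>\<alpha>\<close> keeps \<open>circ\<close> injective, so that
  the image is a genuine arc. The value 0 is allowed because a defining relator may consist of its
  last letter alone; the arc is then a point.\<close>

lemma circ_arc_retract:
  assumes "0 \<le> \<alpha>" "\<alpha> < 1"
  shows "(circ ` {0..\<alpha>}) retract_of cball 0 1"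
proof (intro AR_imp_retract conjI)
  have "inj_on circ {0..\<alpha>}"
    using assms by (intro inj_on_subset[OF inj_on_circ]) auto
  then have "{0..\<alpha>} homeomorphic circ ` {0..\<alpha>}"
    using homeomorphic_compact[OF compact_Icc continuous_on_circ] by blast
  moreover have "AR {0..\<alpha>}" using assms by (intro convex_imp_AR) auto
  ultimately show "AR (circ ` {0..\<alpha>})" using homeomorphic_AR_iff_AR by blast
  have "compact (circ ` {0..\<alpha>})"
    by (intro compact_continuous_image continuous_on_circ) auto
  then show "closedin (top_of_set (cball 0 1)) (circ ` {0..\<alpha>})"
    by (auto intro!: closed_subset compact_imp_closed)
qed

text \<open>A relator in N carries the name of the generator that it defines, so that generators and
  relators share one index type.\<close>
locale free_faces =
  fixes G I N :: "'g set" and R :: "'g \<Rightarrow> ('g \<times> bool) list" and U :: "'g \<Rightarrow> ('g \<times> bool) list"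
    and \<sigma> :: "'g \<Rightarrow> bool"
  assumes GN: "G \<inter> N = {}" and IN: "I \<inter> N = {}"
    and RN: "m \<in> N \<Longrightarrow> R m = U m @ [(m, \<sigma> m)]"
    and UG: "m \<in> N \<Longrightarrow> fst ` set (U m) \<subseteq> G"
begin

text \<open>The relator of m has \<open>length (U m) + 1\<close> letters on equal arcs, the free one
  being the last; so \<open>U m\<close> occupies the circle from parameter 0 to
  \<open>\<alpha> m\<close>.\<close>

definition \<alpha> :: "'g \<Rightarrow> real" where
  "\<alpha> m = length (U m) / (length (U m) + 1)"

text \<open>The part of the boundaries that is glued to the smaller complex. What remains of each
  disc is its interior and the open free edge, exactly the two cells that m adds.\<close>

definition arcs :: "('g \<times> (real \<times> real)) set" where
  "arcs = {(m, circ s) | m s. m \<in> N \<and> 0 \<le> s \<and> s \<le> \<alpha> m}"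

lemma \<alpha>_bounds: "0 \<le> \<alpha> m" "\<alpha> m < 1"
  by (auto simp: \<alpha>_def)

lemma arcs_subset: "arcs \<subseteq> N \<times> cball 0 1"
  by (auto simp: arcs_def)

lemma dpt_arc:
  assumes m: "m \<in> N" and s: "0 \<le> s" "s \<le> \<alpha> m"
  shows "dpt R m (circ s) = word_path (U m) (s / \<alpha> m)"
proof -
  let ?n = "real (length (U m))"
  have s1: "s \<in> {0..1}" using s \<alpha>_bounds(2)[of m] by auto
  show ?thesis
  proof (cases "U m = []")
    \<comment> \<open>Here \<open>\<alpha> m\<close> is 0, so s is 0 and both sides are
      \<open>Base\<close>, whatever the value of the quotient.\<close>
    case True
    then show ?thesis using s dpt_circ[of 0 R m] by (simp add: \<alpha>_def)
  next
    case False
    then have n: "?n > 0" by simp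
    have s': "s / \<alpha> m \<in> {0..1}" using s \<alpha>_bounds(1)[of m] by (auto simp: divide_le_eq_1)
    have eq: "?n * (s / \<alpha> m) = (?n + 1) * s" using n by (simp add: \<alpha>_def field_simps)
    obtain j where j: "j < length (U m)" "real j \<le> ?n * (s / \<alpha> m)" "?n * (s / \<alpha> m) \<le> real j + 1"
      using word_path_cases[OF False s'] by blast
    have len: "real (length (R m)) = ?n + 1" by (simp add: RN[OF m])
    have "word_path (R m) s = letter (R m ! j) ((?n + 1) * s - j)"
      using j word_path_nth[of j "R m" s] unfolding eq len by (simp add: RN[OF m])
    also have "R m ! j = U m ! j" using j by (simp add: RN[OF m] nth_append)
    finally show ?thesis
      using word_path_nth[OF j] unfolding eq by (simp add: dpt_circ[OF s1])
  qed
qed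

lemma dpt_free_edge:
  fixes s :: real
  assumes m: "m \<in> N" and s: "\<alpha> m \<le> s" "s \<le> 1"
  shows "dpt R m (circ s) = letter (m, \<sigma> m) ((length (U m) + 1) * s - length (U m))"
proof -
  let ?n = "real (length (U m))"
  have s1: "s \<in> {0..1}" using s \<alpha>_bounds(1)[of m] by auto
  have len: "real (length (R m)) = ?n + 1" by (simp add: RN[OF m])
  have "?n \<le> (?n + 1) * s" using s(1) by (simp add: \<alpha>_def field_simps)
  moreover have "(?n + 1) * s \<le> ?n + 1" using s(2) by (simp add: mult_left_le)
  ultimately have "word_path (R m) s = letter (R m ! length (U m)) ((?n + 1) * s - ?n)"
    using word_path_nth[of "length (U m)" "R m" s] unfolding len by (simp add: RN[OF m])
  then show ?thesis by (simp add: dpt_circ[OF s1] RN[OF m] add.commute)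
qed

text \<open>The final equation determines s from t, which makes \<open>dpt\<close> injective along
  the free edges too; \<open>\<sigma> m\<close> decides in which direction the edge is
  traversed.\<close>

lemma dpt_off_arcs:
  fixes z :: "real \<times> real"
  assumes m: "m \<in> N" and z: "norm z \<le> 1" "(m, z) \<notin> arcs"
  obtains "norm z < 1" "dpt R m z = Disc m z"
  | s t :: real where "z = circ s" "0 < t" "t < 1" "dpt R m z = Edge m t"
      "(length (U m) + 1) * s - length (U m) = (if \<sigma> m then t else 1 - t)"
proof (cases "norm z = 1")
  case True
  define s where "s = circ_param z"
  define u where "u = (length (U m) + 1) * s - length (U m)"
  have s: "s \<in> {0..<1}" "z = circ s" using circ_param[OF True] by (auto simp: s_def)
  then have sa: "\<alpha> m < s" using z m by (force simp: arcs_def)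
  have u: "0 < u" "u < 1"
  proof -
    show "0 < u" using sa by (simp add: u_def \<alpha>_def field_simps)
    have "(real (length (U m)) + 1) * s < (real (length (U m)) + 1) * 1"
      using s by (intro mult_strict_left_mono) auto
    then show "u < 1" by (simp add: u_def algebra_simps)
  qed
  have "dpt R m z = letter (m, \<sigma> m) u"
    using dpt_free_edge[OF m, of s] sa s by (simp add: u_def)
  then have "dpt R m z = Edge m (if \<sigma> m then u else 1 - u)"
    using u by (simp add: letter_def ept_def)
  then show ?thesis
    using u s(2) by (intro that(2)[of s "if \<sigma> m then u else 1 - u"]) (auto simp: u_def)
next
  case False
  then show ?thesis using z by (intro that(1)) (auto simp: dpt_def)
qed

text \<open>The parameter s solves the equation of \<open>dpt_free_edge\<close> for the given edge
  point. So the disc alone accounts for the new edge, for its points as well as its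
  topology.\<close>

lemma free_edge_eq_dpt:
  fixes t :: real
  assumes m: "m \<in> N" and t: "t \<in> {0..1}"
  defines "s \<equiv> (length (U m) + (if \<sigma> m then t else 1 - t)) / (length (U m) + 1)"
  shows "ept m t = dpt R m (circ s)"
proof -
  have "\<alpha> m \<le> s" "s \<le> 1" using t by (auto simp: s_def \<alpha>_def divide_simps)
  from dpt_free_edge[OF m this] show ?thesis
    by (simp add: s_def letter_def split: if_splits)
qed

context
  assumes RG: "words_in G I R"
begin

lemma words_in_free: "words_in (G \<union> N) (I \<union> N) R"
  using RG RN UG by (fastforce simp: words_in_def)

text \<open>A disc glued along an arc only brings its free edge with it. Edges and discs of N are
  thus adjoined in one pushout, without an intermediate complex that has the new edges but not the
  discs.\<close>

lemma pushout_free_faces: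
  "pushout (cpx G I R) (prod_topology (discrete_topology N) disc_top) arcs
     (\<lambda>(m,z). dpt R m z) (cpx (G \<union> N) (I \<union> N) R) id (\<lambda>(m,z). dpt R m z)"
proof -
  note R = words_in_free
  let ?E = "prod_topology (discrete_topology N) disc_top"
  have top: "topspace (cpx (G \<union> N) (I \<union> N) R) = cells (G \<union> N) (I \<union> N)" "topspace (cpx G I R) = cells G I"
    using R RG by (simp_all add: topspace_cpx)
  have topE: "topspace ?E = N \<times> cball 0 1" by simp
  have bd: "dpt R m z \<in> cells G I" if "(m, z) \<in> arcs" for m z
  proof -
    from that obtain s where s: "m \<in> N" "z = circ s" "0 \<le> s" "s \<le> \<alpha> m" by (auto simp: arcs_def)
    then show ?thesis
      using dpt_arc[OF s(1,3,4)] UG \<alpha>_bounds(1)[of m]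
      by (auto intro!: word_path_in_cells simp: divide_le_eq_1)
  qed
  show ?thesis
    unfolding pushout_def top
  proof (intro conjI ballI allI impI)
    show "arcs \<subseteq> topspace ?E" using arcs_subset by simp
    show "continuous_map (cpx G I R) (cpx (G \<union> N) (I \<union> N) R) id"
      using R RG by (intro continuous_map_cpx_inclusion) auto
    show "continuous_map ?E (cpx (G \<union> N) (I \<union> N) R) (\<lambda>(m,z). dpt R m z)"
      using R by (intro continuous_map_prod_discrete) (auto intro!: continuous_map_dpt)
    show "inj_on (\<lambda>(m,z). dpt R m z) (topspace ?E - arcs)"
    proof (rule inj_onI, clarify)
      fix m and z :: "real \<times> real" and m' and z' :: "real \<times> real"
      assume a: "(m, z) \<in> topspace ?E" "(m, z) \<notin> arcs" "(m', z') \<in> topspace ?E" "(m', z') \<notin> arcs"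
        "dpt R m z = dpt R m' z'"
      then have m: "m \<in> N" "norm z \<le> 1" "m' \<in> N" "norm z' \<le> 1" by auto
      show "m = m' \<and> z = z'"
      proof (rule dpt_off_arcs[OF m(1,2) a(2)])
        assume 1: "dpt R m z = Disc m z"
        show ?thesis
          by (rule dpt_off_arcs[OF m(3,4) a(4)]) (use 1 a(5) in simp_all)
      next
        fix s t :: real
        assume 1: "z = circ s" "dpt R m z = Edge m t"
          "(length (U m) + 1) * s - length (U m) = (if \<sigma> m then t else 1 - t)"
        show ?thesis
        proof (rule dpt_off_arcs[OF m(3,4) a(4)])
          assume "dpt R m' z' = Disc m' z'"
          then show ?thesis using 1(2) a(5) by simp
        next
          fix s' t' :: real
          assume 2: "z' = circ s'" "dpt R m' z' = Edge m' t'"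
            "(length (U m') + 1) * s' - length (U m') = (if \<sigma> m' then t' else 1 - t')"
          have "m = m'" "t = t'" using 1(2) 2(2) a(5) by auto
          with 1(3) 2(3) have "(length (U m) + 1) * s - length (U m) = (length (U m) + 1) * s' - length (U m)"
            by metis
          then have "(real (length (U m)) + 1) * s = (real (length (U m)) + 1) * s'"
            by (simp add: add.commute)
          then have "s = s'" unfolding mult_cancel_left by linarith
          with \<open>m = m'\<close> 1(1) 2(1) show ?thesis by simp
        qed
      qed
    qed
    show "id ` cells G I \<inter> (\<lambda>(m,z). dpt R m z) ` (topspace ?E - arcs) = {}"
    proof -
      have "dpt R m z \<notin> cells G I" if "m \<in> N" "norm z \<le> 1" "(m, z) \<notin> arcs" for m z
        using that(1) GN IN by (rule_tac dpt_off_arcs[OF that]) (auto simp: cells_def)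
      then show ?thesis by fastforce
    qed
    show "cells (G \<union> N) (I \<union> N) = id ` cells G I \<union> (\<lambda>(m,z). dpt R m z) ` topspace ?E"
    proof (intro equalityI subsetI)
      fix x assume "x \<in> cells (G \<union> N) (I \<union> N)"
      then consider "x \<in> cells G I" | m z where "m \<in> N" "norm z < 1" "x = Disc m z"
        | m t where "m \<in> N" "0 < t" "t < 1" "x = Edge m t"
        unfolding cells_def by blast
      then show "x \<in> id ` cells G I \<union> (\<lambda>(m,z). dpt R m z) ` topspace ?E"
      proof cases
        case 2
        then have "(m, z) \<in> topspace ?E" "x = (case (m, z) of (m, z) \<Rightarrow> dpt R m z)"
          by (auto simp: dpt_def)
        then show ?thesis by (intro UnI2) (rule image_eqI)
      next
        case 3
        then have "x = ept m t" by (simp add: ept_def)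
        also have "\<dots> = dpt R m (circ ((length (U m) + (if \<sigma> m then t else 1 - t)) / (length (U m) + 1)))"
          using 3 by (intro free_edge_eq_dpt) auto
        finally have "x = (case (m, circ ((length (U m) + (if \<sigma> m then t else 1 - t)) / (length (U m) + 1))) of (m, z) \<Rightarrow> dpt R m z)"
          by simp
        then show ?thesis using 3 by (intro UnI2) (erule image_eqI, simp)
      qed auto
    next
      fix x assume "x \<in> id ` cells G I \<union> (\<lambda>(m,z). dpt R m z) ` topspace ?E"
      then show "x \<in> cells (G \<union> N) (I \<union> N)"
        using cells_mono[of G "G \<union> N" I "I \<union> N"] dpt_in_cells[OF R] by auto
    qed
    fix V assume V: "V \<subseteq> cells (G \<union> N) (I \<union> N) \<and> openin (cpx G I R) {x \<in> cells G I. id x \<in> V} \<and>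
       openin ?E {e \<in> topspace ?E. (case e of (m,z) \<Rightarrow> dpt R m z) \<in> V}"
    then have V1: "\<forall>g\<in>G. openin I01 {t \<in> {0..1}. ept g t \<in> {x \<in> cells G I. id x \<in> V}}"
      "\<forall>i\<in>I. openin disc_top {z \<in> cball 0 1. dpt R i z \<in> {x \<in> cells G I. id x \<in> V}}"
      unfolding openin_cpx by blast+
    have V2: "openin disc_top {z \<in> cball 0 1. dpt R m z \<in> V}" if "m \<in> N" for m
      using V that unfolding openin_prod_discrete by (auto cong: conj_cong)
    show "openin (cpx (G \<union> N) (I \<union> N) R) V"
      unfolding openin_cpx
    proof (intro conjI ballI)
      fix g assume g: "g \<in> G \<union> N"
      show "openin I01 {t \<in> {0..1}. ept g t \<in> V}"
      proof (cases "g \<in> G")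
        case True
        then have eq: "{t \<in> {0..1}. ept g t \<in> {x \<in> cells G I. id x \<in> V}} = {t \<in> {0..1}. ept g t \<in> V}"
          using ept_in_cells[OF True] by auto
        then show ?thesis using bspec[OF V1(1) True] by (simp only: eq)
      next
        case False
        then have m: "g \<in> N" using g by auto
        \<comment> \<open>\<open>?c\<close> runs along the free arc of the disc g at the pace of the
          edge; openness along the edge is pulled back from the disc through it.\<close>
        let ?c = "\<lambda>t::real. circ ((length (U g) + (if \<sigma> g then t else 1 - t)) / (length (U g) + 1))"
        have "continuous_on {0..1} ?c"
          by (intro continuous_on_compose2[OF continuous_on_circ[of UNIV]])
             (cases "\<sigma> g"; auto intro!: continuous_intros)+
        then have "continuous_map I01 disc_top ?c" by auto
        then have "openin I01 {t \<in> topspace I01. ?c t \<in> {z \<in> cball 0 1. dpt R g z \<in> V}}"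
          using V2[OF m] unfolding continuous_map by blast
        also have "{t \<in> topspace I01. ?c t \<in> {z \<in> cball 0 1. dpt R g z \<in> V}} = {t \<in> {0..1}. ept g t \<in> V}"
          using free_edge_eq_dpt[OF m] by auto
        finally show ?thesis .
      qed
    next
      fix i assume i: "i \<in> I \<union> N"
      show "openin disc_top {z \<in> cball 0 1. dpt R i z \<in> V}"
      proof (cases "i \<in> I")
        case True
        then have eq: "{z \<in> cball 0 1. dpt R i z \<in> {x \<in> cells G I. id x \<in> V}} = {z \<in> cball 0 1. dpt R i z \<in> V}"
          using dpt_in_cells[OF RG] by auto
        then show ?thesis using bspec[OF V1(2) True] by (simp only: eq)
      next
        case False
        then show ?thesis using V2 i by auto
      qed
    qed (use V in auto)
  qed (use bd in auto)
qed

theorem collapse_free_faces: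
  "cpx (G \<union> N) (I \<union> N) R homotopy_equivalent_space cpx G I R"
proof -
  have "\<exists>r. continuous_on (cball 0 1) r \<and> r ` cball 0 1 \<subseteq> circ ` {0..\<alpha> m} \<and> (\<forall>z\<in>circ ` {0..\<alpha> m}. r z = z)" for m
    using circ_arc_retract[OF \<alpha>_bounds, of m]
    unfolding retract_of_def retraction_def by (auto simp: image_subset_iff Pi_iff)
  then obtain r where r: "\<And>m. continuous_on (cball 0 1) (r m)" "\<And>m. r m ` cball 0 1 \<subseteq> circ ` {0..\<alpha> m}"
      "\<And>m z. z \<in> circ ` {0..\<alpha> m} \<Longrightarrow> r m z = z"
    by metis
  \<comment> \<open>J is the attaching set itself, so nothing of the discs survives the deformation
    except what was already glued, and the target is the complex to which they were
    attached.\<close>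
  show ?thesis
  proof (rule pushout_deformation_convex[OF pushout_free_faces, where r = r and J = arcs and i' = id
        and \<rho> = "\<lambda>(m,z). dpt R m z" and F = id])
    show "(m, r m z) \<in> arcs" if "m \<in> N" "z \<in> cball 0 1" for m z
      using r(2)[of m] that by (fastforce simp: arcs_def)
    show "r m z = z" if "(m, z) \<in> arcs" for m z
      using that r(3)[of z m] by (auto simp: arcs_def)
    show "continuous_map (subtopology (prod_topology (discrete_topology N) disc_top) arcs) (cpx G I R) (\<lambda>(m,z). dpt R m z)"
    proof (rule continuous_map_subtopology_prod_discrete)
      fix m assume m: "m \<in> N"
      have eq: "subtopology disc_top {z. (m, z) \<in> arcs} = top_of_set (circ ` {0..\<alpha> m})"
      proof -
        have "cball 0 1 \<inter> {z. (m, z) \<in> arcs} = circ ` {0..\<alpha> m}" using m by (auto simp: arcs_def)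
        then show ?thesis by (simp add: subtopology_subtopology)
      qed
      have "continuous_map (top_of_set {0..\<alpha> m}) (cpx G I R) (word_path (U m) \<circ> (\<lambda>s. s / \<alpha> m))"
      proof (rule continuous_map_compose)
        show "continuous_map I01 (cpx G I R) (word_path (U m))"
          using RG UG[OF m] by (rule continuous_map_word_path_cpx)
        show "continuous_map (top_of_set {0..\<alpha> m}) I01 (\<lambda>s. s / \<alpha> m)"
        proof -
          \<comment> \<open>Multiplication by a constant is continuous even if
            \<open>\<alpha> m\<close> is 0, when the inverse is 0 by convention.\<close>
          have "continuous_on {0..\<alpha> m} (\<lambda>s. s * inverse (\<alpha> m))" by (intro continuous_intros)
          then show ?thesis
            using \<alpha>_bounds(1)[of m] by (auto simp: divide_inverse[symmetric] divide_le_eq_1)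
        qed
      qed
      then have "continuous_map (top_of_set {0..\<alpha> m}) (cpx G I R) (dpt R m \<circ> circ)"
        by (rule continuous_map_eq) (use dpt_arc[OF m] in auto)
      then show "continuous_map (subtopology disc_top {z. (m, z) \<in> arcs}) (cpx G I R)
          (\<lambda>x. case (m, x) of (m, z) \<Rightarrow> dpt R m z)"
        unfolding eq using continuous_compose_quotient_map[OF quotient_map_circ] by simp
    qed
    show "continuous_map (cpx G I R) (cpx (G \<union> N) (I \<union> N) R) id"
      using RG words_in_free by (intro continuous_map_cpx_inclusion) auto
  qed (use r arcs_subset in auto)
qed

end

end

section \<open>Homotopic attaching maps\<close>

text \<open>Radial projection from the point (0, 2) above the cylinder.\<close>
lemma cylinder_retract_bottom:
  fixes r :: "(real \<times> real) \<times> real \<Rightarrow> (real \<times> real) \<times> real"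
  defines "\<mu> \<equiv> \<lambda>x. 2 / max (2 * norm (fst x)) (2 - snd x)"
  defines "r \<equiv> \<lambda>x. (\<mu> x *\<^sub>R fst x, 2 - \<mu> x * (2 - snd x))"
  shows "continuous_on (cball 0 1 \<times> {0..1}) r"
    "\<And>x. x \<in> cball 0 1 \<times> {0..1} \<Longrightarrow> r x \<in> cball 0 1 \<times> {0} \<union> sphere 0 1 \<times> {0..1}"
    "\<And>x. x \<in> cball 0 1 \<times> {0} \<union> sphere 0 1 \<times> {0..1} \<Longrightarrow> r x = x"
proof -
  show "continuous_on (cball 0 1 \<times> {0..1}) r"
    unfolding r_def \<mu>_def by (intro continuous_intros) (auto simp: max_def)
  show "r x \<in> cball 0 1 \<times> {0} \<union> sphere 0 1 \<times> {0..1}" if x: "x \<in> cball 0 1 \<times> {0..1}" for x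
  proof -
    obtain z t where zt: "x = (z, t)" by (cases x)
    have z: "norm z \<le> 1" "0 \<le> t" "t \<le> 1" using x by (auto simp: zt)
    \<comment> \<open>The ray from (0, 2) through x meets the bottom after scaling by 2 / (2 - t)
      and the side after scaling by 1 / norm z. \<open>\<mu> x\<close> is the smaller factor, and
      the case distinction tells which face is met first.\<close>
    show ?thesis
    proof (cases "2 * norm z \<le> 2 - t")
      case True
      then have m: "\<mu> x = 2 / (2 - t)" by (simp add: \<mu>_def zt max_def)
      have "(4 - 2 * t) / (2 - t) = 2" using z by (simp add: field_simps)
      then show ?thesis using True z m by (simp add: r_def zt divide_le_eq_1)
    next
      case False
      then have m: "\<mu> x = 1 / norm z" by (simp add: \<mu>_def zt max_def)
      have "norm z > 0" using False z by auto
      moreover have "(2 - t) / norm z \<ge> 1" using False z \<open>norm z > 0\<close> by (simp add: divide_simps)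
      moreover have "(2 - t) / norm z \<le> 2" using False \<open>norm z > 0\<close> by (simp add: divide_simps)
      ultimately show ?thesis by (simp add: r_def zt m[unfolded zt])
    qed
  qed
  show "r x = x" if x: "x \<in> cball 0 1 \<times> {0} \<union> sphere 0 1 \<times> {0..1}" for x
  proof -
    have "\<mu> x = 1" using x by (auto simp: \<mu>_def max_def)
    then show ?thesis by (simp add: r_def prod_eq_iff)
  qed
qed

lemma cylinder_retract:
  fixes c :: real
  assumes c: "c \<in> {0, 1}"
  obtains r :: "(real \<times> real) \<times> real \<Rightarrow> (real \<times> real) \<times> real"
  where "continuous_on (cball 0 1 \<times> {0..1}) r"
    "\<And>x. x \<in> cball 0 1 \<times> {0..1} \<Longrightarrow> r x \<in> cball 0 1 \<times> {c} \<union> sphere 0 1 \<times> {0..1}"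
    "\<And>x. x \<in> cball 0 1 \<times> {c} \<union> sphere 0 1 \<times> {0..1} \<Longrightarrow> r x = x"
proof -
  obtain r :: "(real \<times> real) \<times> real \<Rightarrow> (real \<times> real) \<times> real"
  where r: "continuous_on (cball 0 1 \<times> {0..1}) r"
    "\<And>x. x \<in> cball 0 1 \<times> {0..1} \<Longrightarrow> r x \<in> cball 0 1 \<times> {0} \<union> sphere 0 1 \<times> {0..1}"
    "\<And>x. x \<in> cball 0 1 \<times> {0} \<union> sphere 0 1 \<times> {0..1} \<Longrightarrow> r x = x"
    using cylinder_retract_bottom by blast
  show ?thesis
  proof (cases "c = 0")
    case True
    then show ?thesis using that r by blast
  next
    case False
    then have c1: "c = 1" using c by auto
    define f :: "(real \<times> real) \<times> real \<Rightarrow> (real \<times> real) \<times> real" where "f x = (fst x, 1 - snd x)" for x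
    have f: "continuous_on A f" for A unfolding f_def by (intro continuous_intros)
    have fC: "f x \<in> cball 0 1 \<times> {0..1}" if "x \<in> cball 0 1 \<times> {0..1}" for x
      using that by (auto simp: f_def)
    have ff: "f (f x) = x" for x by (simp add: f_def)
    have fJ: "f x \<in> cball 0 1 \<times> {0} \<union> sphere 0 1 \<times> {0..1} \<longleftrightarrow> x \<in> cball 0 1 \<times> {1} \<union> sphere 0 1 \<times> {0..1}" for x
      by (cases x) (auto simp: f_def)
    show ?thesis
    proof (rule that[of "f \<circ> r \<circ> f"])
      have "continuous_on (cball 0 1 \<times> {0..1}) (r \<circ> f)"
        unfolding o_def using fC by (intro continuous_on_compose2[OF r(1) f]) blast
      then show "continuous_on (cball 0 1 \<times> {0..1}) (f \<circ> r \<circ> f)"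
        using continuous_on_compose[of _ "r \<circ> f" f] f by (simp add: o_assoc)
      show "(f \<circ> r \<circ> f) x \<in> cball 0 1 \<times> {c} \<union> sphere 0 1 \<times> {0..1}" if "x \<in> cball 0 1 \<times> {0..1}" for x
        using r(2)[OF fC[OF that]] fJ[of "f (r (f x))"] by (simp add: c1 ff)
      show "(f \<circ> r \<circ> f) x = x" if "x \<in> cball 0 1 \<times> {c} \<union> sphere 0 1 \<times> {0..1}" for x
        using r(3)[of "f x"] fJ[of x] that by (simp add: c1 ff)
    qed
  qed
qed

text \<open>Retracting the cylinder to its side and one end leaves a disc glued by that end of
  \<open>\<Phi>\<close>. Allowing c to be either end yields both halves of
  \<open>attach_discs_homotopic\<close> from one proof.\<close>

lemma attach_cylinders_end:
  fixes \<Phi> :: "'g \<times> (real \<times> real) \<times> real \<Rightarrow> 'g pt" and c :: real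
  assumes R: "words_in G (I \<union> M) R" and IM: "I \<inter> M = {}"
    and po: "pushout (cpx G I R) (prod_topology (discrete_topology M) (top_of_set (cball 0 1 \<times> {0..1})))
      (M \<times> (sphere 0 1 \<times> {0..1})) \<Phi> Z i j"
    and \<Phi>: "\<And>m. m \<in> M \<Longrightarrow> continuous_map (top_of_set (sphere 0 1 \<times> {0..1})) (cpx G I R) (\<lambda>x. \<Phi> (m, x))"
    and \<Phi>c: "\<And>m z. m \<in> M \<Longrightarrow> norm z = 1 \<Longrightarrow> \<Phi> (m, (z, c)) = dpt R m z"
    and c: "c \<in> {0, 1}"
  shows "Z homotopy_equivalent_space cpx G (I \<union> M) R"
proof -
  have RG: "words_in G I R" using R by (auto simp: words_in_def)
  define J' where "J' = cball (0::real\<times>real) 1 \<times> {c} \<union> sphere 0 1 \<times> {0..1}"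
  \<comment> \<open>On \<open>J'\<close> the test holds exactly on the end at height c, since on the
    side its right-hand side is 0. Being a comparison of continuous functions it fits
    \<open>continuous_map_cases_le\<close>; the branches overlap in the rim, where
    \<open>\<Phi>c\<close> makes them agree.\<close>
  define \<rho> where "\<rho> = (\<lambda>(m, x). if \<bar>snd x - c\<bar> \<le> 1 - norm (fst x) then dpt R m (fst x) else \<Phi> (m, x))"
  have c01: "0 \<le> c" "c \<le> 1" using c by auto
  obtain r :: "(real \<times> real) \<times> real \<Rightarrow> (real \<times> real) \<times> real"
  where r: "continuous_on (cball 0 1 \<times> {0..1}) r"
    "\<And>x. x \<in> cball 0 1 \<times> {0..1} \<Longrightarrow> r x \<in> J'"
    "\<And>x. x \<in> J' \<Longrightarrow> r x = x"
    using cylinder_retract[OF c] unfolding J'_def by blast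
  note pc = pushoutD[OF po]
  note pd = pushout_attach_discs[OF R IM]
  note pdD = pushoutD[OF pd]
  have \<rho>1: "\<rho> (m, (z, c)) = dpt R m z" if "m \<in> M" "norm z \<le> 1" for m z
    using that by (simp add: \<rho>_def)
  have \<rho>2: "\<rho> (m, (z, t)) = \<Phi> (m, (z, t))" if "m \<in> M" "norm z = 1" for m z t
    using that \<Phi>c by (auto simp: \<rho>_def)
  have jc: "continuous_map (prod_topology (discrete_topology M) disc_top) Z (\<lambda>(m, z). j (m, (z, c)))"
  proof (intro continuous_map_prod_discrete)
    fix m assume m: "m \<in> M"
    have "continuous_map disc_top (prod_topology (discrete_topology M) (top_of_set (cball 0 1 \<times> {0..1}))) (\<lambda>z. (m, (z, c)))"
      using m c01 by (intro continuous_map_pairedI) (auto intro!: continuous_intros)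
    from continuous_map_compose[OF this pc(3)]
    show "continuous_map disc_top Z (\<lambda>x. case (m, x) of (m, z) \<Rightarrow> j (m, (z, c)))" by (simp add: o_def)
  qed
  obtain F where F: "continuous_map (cpx G (I \<union> M) R) Z F"
    "\<And>x. x \<in> topspace (cpx G I R) \<Longrightarrow> F x = i x"
    "\<And>m z. m \<in> M \<Longrightarrow> norm z \<le> 1 \<Longrightarrow> F (dpt R m z) = j (m, (z, c))"
  proof (rule pushout_map_out[OF pd pc(2) jc])
    fix e assume e: "e \<in> M \<times> sphere (0::real\<times>real) 1"
    then obtain m z where mz: "e = (m, z)" "m \<in> M" "norm z = 1" by auto
    then show "(case e of (m, z) \<Rightarrow> j (m, z, c)) = i (case e of (m, z) \<Rightarrow> dpt R m z)"
      using pc(5)[of "(m, (z, c))"] \<Phi>c c01 by auto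
  next
    fix F assume F: "continuous_map (cpx G (I \<union> M) R) Z F"
      "\<And>x. x \<in> topspace (cpx G I R) \<Longrightarrow> F (id x) = i x"
      "\<And>e. e \<in> topspace (prod_topology (discrete_topology M) disc_top) \<Longrightarrow>
         F (case e of (m, z) \<Rightarrow> dpt R m z) = (case e of (m, z) \<Rightarrow> j (m, z, c))"
    have "F (dpt R m z) = j (m, (z, c))" if "m \<in> M" "norm z \<le> 1" for m z
      using F(3)[of "(m, z)"] that by simp
    then show thesis using F that by simp
  qed
  show ?thesis
  proof (rule pushout_deformation_convex[OF po, where r = "\<lambda>_. r" and J = "M \<times> J'" and i' = id and \<rho> = \<rho> and F = F])
    show "convex (cball (0::real\<times>real) 1 \<times> {0..1::real})" by (intro convex_Times) auto
    show "continuous_map (cpx G I R) (cpx G (I \<union> M) R) id" by (rule pdD(2))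
    show "continuous_map (subtopology (prod_topology (discrete_topology M) (top_of_set (cball 0 1 \<times> {0..1}))) (M \<times> J'))
       (cpx G (I \<union> M) R) \<rho>"
    proof (rule continuous_map_subtopology_prod_discrete)
      fix m assume m: "m \<in> M"
      have eq: "subtopology (top_of_set (cball 0 1 \<times> {0..1})) {x. (m, x) \<in> M \<times> J'} = top_of_set J'"
      proof -
        have "(cball 0 1 \<times> {0..1}) \<inter> {x. (m, x) \<in> M \<times> J'} = J'" using m c01 by (auto simp: J'_def)
        then show ?thesis by (simp add: subtopology_subtopology)
      qed
      have "continuous_map (top_of_set J') (cpx G (I \<union> M) R)
          (\<lambda>x. if \<bar>snd x - c\<bar> \<le> 1 - norm (fst x) then dpt R m (fst x) else \<Phi> (m, x))"
      proof (rule continuous_map_cases_le)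
        show "continuous_map (top_of_set J') euclideanreal (\<lambda>x. \<bar>snd x - c\<bar>)"
          "continuous_map (top_of_set J') euclideanreal (\<lambda>x. 1 - norm (fst x))"
          by (auto intro!: continuous_intros)
        have "continuous_map (subtopology (top_of_set J') {x \<in> topspace (top_of_set J'). \<bar>snd x - c\<bar> \<le> 1 - norm (fst x)}) disc_top fst"
          unfolding subtopology_subtopology by (auto simp: J'_def intro!: continuous_intros)
        from continuous_map_compose[OF this continuous_map_dpt[OF R, of m]] m
        show "continuous_map (subtopology (top_of_set J') {x \<in> topspace (top_of_set J'). \<bar>snd x - c\<bar> \<le> 1 - norm (fst x)})
            (cpx G (I \<union> M) R) (\<lambda>x. dpt R m (fst x))" by (simp add: o_def)
        have "J' \<inter> {x \<in> topspace (top_of_set J'). 1 - norm (fst x) \<le> \<bar>snd x - c\<bar>} \<subseteq> sphere 0 1 \<times> {0..1}"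
          using c01 by (auto simp: J'_def)
        moreover have "continuous_map (top_of_set (sphere 0 1 \<times> {0..1})) (cpx G (I \<union> M) R) (\<lambda>x. \<Phi> (m, x))"
          using continuous_map_compose[OF \<Phi>[OF m] pdD(2)] by (simp add: o_def)
        ultimately show "continuous_map (subtopology (top_of_set J') {x \<in> topspace (top_of_set J'). 1 - norm (fst x) \<le> \<bar>snd x - c\<bar>})
            (cpx G (I \<union> M) R) (\<lambda>x. \<Phi> (m, x))"
          unfolding subtopology_subtopology by (rule continuous_map_from_subtopology_mono[rotated])
      next
        fix x assume x: "x \<in> topspace (top_of_set J')" "\<bar>snd x - c\<bar> = 1 - norm (fst x)"
        then have "norm (fst x) = 1" "snd x = c" by (auto simp: J'_def)
        then show "dpt R m (fst x) = \<Phi> (m, x)" using \<Phi>c[OF m, of "fst x"] by (metis prod.collapse)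
      qed
      then show "continuous_map (subtopology (top_of_set (cball 0 1 \<times> {0..1})) {x. (m, x) \<in> M \<times> J'})
          (cpx G (I \<union> M) R) (\<lambda>x. \<rho> (m, x))"
        unfolding eq by (simp add: \<rho>_def)
    qed
    show "\<rho> e = id (\<Phi> e)" if "e \<in> M \<times> sphere 0 1 \<times> {0..1}" for e
      using that \<rho>2 by auto
    show "F (id x) = i x" if "x \<in> topspace (cpx G I R)" for x using F(2)[OF that] by simp
    show "F (\<rho> e) = j e" if eJ: "e \<in> M \<times> J'" for e
    proof -
      obtain m z t where e: "e = (m, (z, t))" by (metis prod.exhaust)
      consider "m \<in> M" "norm z \<le> 1" "t = c" | "m \<in> M" "norm z = 1" "t \<in> {0..1}"
        using eJ by (auto simp: e J'_def)
      then show ?thesis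
      proof cases
        case 1
        then show ?thesis using \<rho>1 F(3) by (simp add: e)
      next
        case 2
        then show ?thesis using \<rho>2[OF 2(1,2)] F(2) pc(4,5)[of e] by (simp add: e)
      qed
    qed
    show "topspace (cpx G (I \<union> M) R) \<subseteq> id ` topspace (cpx G I R) \<union> \<rho> ` (M \<times> J')"
    proof
      fix x assume "x \<in> topspace (cpx G (I \<union> M) R)"
      then consider "x \<in> topspace (cpx G I R)" | m z where "m \<in> M" "norm z \<le> 1" "x = dpt R m z"
        unfolding pdD(9) by auto
      then show "x \<in> id ` topspace (cpx G I R) \<union> \<rho> ` (M \<times> J')"
      proof cases
        case 2
        then have "x = \<rho> (m, (z, c))" "(m, (z, c)) \<in> M \<times> J'" using \<rho>1 by (auto simp: J'_def)
        then show ?thesis by blast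
      qed auto
    qed
  qed (use r F c01 in \<open>auto simp: J'_def\<close>)
qed

text \<open>Free and not based: a cyclic permutation of a relator moves the starting point of its
  path around the loop.\<close>

definition freely_homotopic :: "'a topology \<Rightarrow> (real \<times> real \<Rightarrow> 'a) \<Rightarrow> (real \<times> real \<Rightarrow> 'a) \<Rightarrow> bool" where
  "freely_homotopic T f g \<longleftrightarrow> (\<exists>\<Phi>. continuous_map (top_of_set (sphere 0 1 \<times> {0..1::real})) T \<Phi> \<and>
     (\<forall>z\<in>sphere 0 1. \<Phi> (z, 0) = f z \<and> \<Phi> (z, 1) = g z))"

lemma cpx_cong: "(\<And>i. i \<in> I \<Longrightarrow> R i = R' i) \<Longrightarrow> cpx G I R = cpx G I R'"
  unfolding cpx_def by (intro arg_cong[where f = topology] ext) (simp add: dpt_def)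

text \<open>The homotopies run in the complex that already contains the discs of I, so these discs
  may be crossed when attaching maps of M are changed. That complex is common to both sides, and the
  same cylinders are read from either end.\<close>

theorem attach_discs_homotopic:
  assumes R: "words_in G (I \<union> M) R" and R': "words_in G (I \<union> M) R'" and IM: "I \<inter> M = {}"
    and RR': "\<And>i. i \<in> I \<Longrightarrow> R i = R' i"
    and h: "\<And>m. m \<in> M \<Longrightarrow> freely_homotopic (cpx G I R) (dpt R m) (dpt R' m)"
  shows "cpx G (I \<union> M) R homotopy_equivalent_space cpx G (I \<union> M) R'"
proof -
  have RG: "words_in G I R" using R by (auto simp: words_in_def)
  have "\<forall>m\<in>M. \<exists>\<Phi>. continuous_map (top_of_set (sphere 0 1 \<times> {0..1::real})) (cpx G I R) \<Phi> \<and>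
     (\<forall>z\<in>sphere 0 1. \<Phi> (z, 0) = dpt R m z \<and> \<Phi> (z, 1) = dpt R' m z)"
    using h unfolding freely_homotopic_def by blast
  from bchoice[OF this] obtain \<Psi> where P: "\<forall>m\<in>M.
      continuous_map (top_of_set (sphere 0 1 \<times> {0..1::real})) (cpx G I R) (\<Psi> m) \<and>
      (\<forall>z\<in>sphere 0 1. \<Psi> m (z, 0) = dpt R m z \<and> \<Psi> m (z, 1) = dpt R' m z)" ..
  have \<Psi>:
    "\<And>m. m \<in> M \<Longrightarrow> continuous_map (top_of_set (sphere 0 1 \<times> {0..1::real})) (cpx G I R) (\<Psi> m)"
    "\<And>m z. m \<in> M \<Longrightarrow> norm z = 1 \<Longrightarrow> \<Psi> m (z, 0) = dpt R m z"
    "\<And>m z. m \<in> M \<Longrightarrow> norm z = 1 \<Longrightarrow> \<Psi> m (z, 1) = dpt R' m z"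
    using P by simp_all
  define \<Phi> where "\<Phi> = (\<lambda>(m, x). \<Psi> m x)"
  have "\<Phi> e \<in> topspace (cpx G I R)" if "e \<in> M \<times> (sphere 0 1 \<times> {0..1})" for e
    using that continuous_map_image_subset_topspace[OF \<Psi>(1)] by (auto simp: \<Phi>_def)
  moreover have "M \<times> (sphere 0 1 \<times> {0..1}) \<subseteq> topspace (prod_topology (discrete_topology M) (top_of_set (cball (0::real\<times>real) 1 \<times> {0..1::real})))"
    by auto
  ultimately obtain Z :: "('a pt + 'a \<times> (real \<times> real) \<times> real) topology" and i j where
    po: "pushout (cpx G I R) (prod_topology (discrete_topology M) (top_of_set (cball 0 1 \<times> {0..1})))
      (M \<times> (sphere 0 1 \<times> {0..1})) \<Phi> Z i j"
    using pushout_exists by blast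
  have "Z homotopy_equivalent_space cpx G (I \<union> M) R"
    using \<Psi> by (intro attach_cylinders_end[OF R IM po, of 0]) (auto simp: \<Phi>_def)
  moreover have "Z homotopy_equivalent_space cpx G (I \<union> M) R'"
  proof -
    have eq: "cpx G I R = cpx G I R'" using RR' by (rule cpx_cong)
    show ?thesis
      using \<Psi>(3) \<Psi>(1)[unfolded eq]
      by (intro attach_cylinders_end[OF R' IM po[unfolded eq], of 1]) (auto simp: \<Phi>_def)
  qed
  ultimately show ?thesis
    using homotopy_equivalent_space_sym homotopy_eqv_trans by blast
qed

lemma freely_homotopic_if_loop_homotopic:
  assumes "loop_homotopic T Base (word_path (R m)) (word_path (R' m))"
  shows "freely_homotopic T (dpt R m) (dpt R' m)"
proof -
  from assms[unfolded loop_homotopic] obtain h where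
    h: "continuous_map (prod_topology I01 I01) T h"
    "\<And>x. x \<in> {0..1} \<Longrightarrow> h (0,x) = word_path (R m) x" "\<And>x. x \<in> {0..1} \<Longrightarrow> h (1,x) = word_path (R' m) x"
    "\<And>t. t \<in> {0..1} \<Longrightarrow> h (t,0) = Base \<and> h (t,1) = Base"
    by auto
  let ?q = "\<lambda>p. (circ (snd p), fst p :: real)"
  let ?\<Phi> = "\<lambda>p. h (snd p, circ_param (fst p))"
  \<comment> \<open>The square wraps onto the cylinder by identifying s = 0 with s = 1. As
    \<open>h\<close> is \<open>Base\<close> on both of these sides, it descends along this quotient
    map.\<close>
  have q: "quotient_map (top_of_set ({0..1} \<times> {0..1})) (top_of_set (sphere 0 1 \<times> {0..1})) ?q"
  proof (rule continuous_imp_quotient_map)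
    show "continuous_map (top_of_set ({0..1} \<times> {0..1})) (top_of_set (sphere 0 1 \<times> {0..1})) ?q"
      by (auto intro!: continuous_intros continuous_on_compose2[OF continuous_on_circ[of UNIV]])
    show "?q ` topspace (top_of_set ({0..1} \<times> {0..1})) = topspace (top_of_set (sphere 0 1 \<times> {0..1}))"
      unfolding sphere_eq_circ by force
  qed (auto simp: compact_space_subtopology compact_Times Hausdorff_space_subtopology)
  have eq: "h (t, circ_param (circ s)) = h (t, s)" if "t \<in> {0..1}" "s \<in> {0..1}" for s t
    using that circ_param_circ[of s] circ_param_circ[of 0] h(4)[OF that(1)] by (cases "s = 1") auto
  have "continuous_map (top_of_set ({0..1} \<times> {0..1})) T (?\<Phi> \<circ> ?q)"
    by (rule continuous_map_eq[of _ _ h]) (use h(1) eq in \<open>auto simp: prod_topology_subtopology_eu\<close>)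
  then have "continuous_map (top_of_set (sphere 0 1 \<times> {0..1})) T ?\<Phi>"
    by (rule continuous_compose_quotient_map[OF q])
  moreover have "?\<Phi> (z, 0) = dpt R m z \<and> ?\<Phi> (z, 1) = dpt R' m z" if "z \<in> sphere 0 1" for z
    using that circ_param(1)[of z] h(2,3) by (auto simp: dpt_def)
  ultimately show ?thesis unfolding freely_homotopic_def by blast
qed

text \<open>Arc j of \<open>v @ u\<close> is arc \<open>length u + j\<close> of \<open>u @ v\<close>
  if j is below \<open>length v\<close>. Otherwise it is arc \<open>j - length v\<close>, reached
  after passing the end of the circle, and \<open>circ_param (circ x)\<close> removes that full
  turn.\<close>

lemma word_path_rotate:
  assumes s: "s \<in> {0..<1}"
  shows "word_path (u @ v) (circ_param (circ (s + length u / length (u @ v)))) = word_path (v @ u) s"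
proof (cases "u @ v = []")
  case False
  define L a where "L = real (length (u @ v))" and "a = real (length u)"
  have L: "L > 0" "a \<ge> 0" "a \<le> L" "L = a + real (length v)" using False by (simp_all add: L_def a_def flip: of_nat_add)
  have len: "real (length (v @ u)) = L" "real (length (u @ v)) = L" by (auto simp: L_def)
  have ne: "v @ u \<noteq> []" using False by auto
  obtain j where j: "j < length (v @ u)" "real j \<le> L * s" "L * s \<le> real j + 1"
    using word_path_cases[OF ne, of s] s unfolding len by auto
  have rhs: "word_path (v @ u) s = letter ((v @ u) ! j) (L * s - j)"
    using word_path_nth[of j "v @ u" s] j unfolding len by simp
  have wrap: "word_path (u @ v) (circ_param (circ x)) = word_path (u @ v) x" if "x \<in> {0..1}" for x
    using that circ_param_circ[of x] circ_param_circ[of 0] by (cases "x = 1") auto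
  show ?thesis
  proof (cases "j < length v")
    case True
    have "L * (s + a / L) = L * s + a" using L by (simp add: field_simps)
    moreover have "real j + 1 \<le> real (length v)" using True by linarith
    ultimately have x: "L * (s + a / L) \<le> L * 1" using j L by linarith
    then have x01: "s + a / L \<in> {0..1}" using L s by (auto simp: mult_le_cancel_left_pos)
    have "word_path (u @ v) (s + a / L) = letter ((u @ v) ! (length u + j)) (L * (s + a / L) - (length u + j))"
      using word_path_nth[of "length u + j" "u @ v" "s + a / L"] True j L unfolding len
      by (simp add: a_def distrib_left)
    also have "\<dots> = letter ((v @ u) ! j) (L * s - j)"
      using True L by (simp add: nth_append a_def distrib_left)
    finally show ?thesis using wrap[OF x01] rhs by (simp add: a_def L_def)
  next
    case False
    have Lx: "L * (s + a / L - 1) = L * s - real (length v)" using L by (simp add: field_simps)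
    have "real (length v) \<le> real j" using False by simp
    then have "0 \<le> L * (s + a / L - 1)" unfolding Lx using j by linarith
    then have "0 \<le> s + a / L - 1" using L by (simp add: zero_le_mult_iff)
    moreover have "a / L \<le> 1" using L by simp
    ultimately have x01: "s + a / L - 1 \<in> {0..1}" using s by auto
    have "circ (s + a / L) = circ (s + a / L - 1)"
      by (simp add: circ_def algebra_simps cos_diff sin_diff)
    moreover have "word_path (u @ v) (s + a / L - 1) = letter ((u @ v) ! (j - length v)) (L * (s + a / L - 1) - (real j - length v))"
      using word_path_nth[of "j - length v" "u @ v" "s + a / L - 1"] False j Lx unfolding len by (auto simp: of_nat_diff)
    moreover have "\<dots> = letter ((v @ u) ! j) (L * s - j)"
      using False j unfolding Lx by (auto simp: nth_append)
    ultimately show ?thesis using wrap[OF x01] rhs by (simp add: a_def L_def)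
  qed
qed auto

text \<open>The circle is rotated before the attaching map is applied. At time 1 the angle is the
  fraction of the circle occupied by u, so the path begins with v; for two empty words this fraction
  is 0 by the convention on division.\<close>

lemma freely_homotopic_rotate:
  assumes R: "words_in G I R0" and uv: "R m = u @ v" "R' m = v @ u" "fst ` set (u @ v) \<subseteq> G"
  shows "freely_homotopic (cpx G I R0) (dpt R m) (dpt R' m)"
proof -
  define c where "c = real (length u) / real (length (u @ v))"
  define \<theta> where "\<theta> t = 2 * pi * (t * c)" for t :: real
  let ?rot = "\<lambda>p :: (real \<times> real) \<times> real. (fst (fst p) * cos (\<theta> (snd p)) - snd (fst p) * sin (\<theta> (snd p)),
      fst (fst p) * sin (\<theta> (snd p)) + snd (fst p) * cos (\<theta> (snd p)))"
  have rot: "?rot (circ s, t) = circ (s + t * c)" for s t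
    by (simp add: circ_def \<theta>_def distrib_left cos_add sin_add algebra_simps)
  have "continuous_on (sphere 0 1 \<times> {0..1}) ?rot"
    unfolding \<theta>_def by (intro continuous_intros)
  moreover have "?rot p \<in> sphere 0 1" if p: "p \<in> sphere 0 1 \<times> {0..1}" for p
  proof -
    obtain s where "fst p = circ s" using p unfolding sphere_eq_circ by auto
    then have "?rot p = circ (s + snd p * c)" using rot[of s "snd p"] by simp
    then show ?thesis by (simp only: mem_sphere dist_0_norm norm_circ)
  qed
  ultimately have crot: "continuous_map (top_of_set (sphere 0 1 \<times> {0..1})) (top_of_set (sphere 0 1)) ?rot"
    by (auto simp del: mem_sphere)
  have "continuous_map I01 (cpx G I R0) (dpt R m \<circ> circ)"
    by (rule continuous_map_eq[OF continuous_map_word_path_cpx[OF R uv(3)]]) (use uv in \<open>auto simp: dpt_circ\<close>)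
  then have "continuous_map (top_of_set (sphere 0 1)) (cpx G I R0) (dpt R m)"
    unfolding sphere_eq_circ by (rule continuous_compose_quotient_map[OF quotient_map_circ])
  then have "continuous_map (top_of_set (sphere 0 1 \<times> {0..1})) (cpx G I R0) (dpt R m \<circ> ?rot)"
    using crot by (rule continuous_map_compose[rotated])
  moreover have "(dpt R m \<circ> ?rot) (z, 0) = dpt R m z \<and> (dpt R m \<circ> ?rot) (z, 1) = dpt R' m z"
    if z: "z \<in> sphere 0 1" for z
  proof
    show "(dpt R m \<circ> ?rot) (z, 0) = dpt R m z" by (simp add: \<theta>_def)
    have n: "norm z = 1" using z by simp
    note cp = circ_param[OF n]
    have "?rot (z, 1) = circ (circ_param z + c)" using rot[of "circ_param z" 1] cp(2) by simp
    then have "(dpt R m \<circ> ?rot) (z, 1) = dpt R m (circ (circ_param z + c))" by (simp only: o_apply)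
    also have "\<dots> = word_path (u @ v) (circ_param (circ (circ_param z + c)))"
      by (simp add: dpt_def uv)
    also have "\<dots> = word_path (v @ u) (circ_param z)"
      unfolding c_def using word_path_rotate[OF cp(1)] by simp
    finally show "(dpt R m \<circ> ?rot) (z, 1) = dpt R' m z" by (simp add: dpt_def uv n)
  qed
  ultimately show ?thesis unfolding freely_homotopic_def by blast
qed

section \<open>Eliminating generators\<close>

lemma loop_homotopic_reverse:
  assumes "loop_homotopic X b p q"
  shows "loop_homotopic X b (\<lambda>s. p (1 - s)) (\<lambda>s. q (1 - s))"
proof -
  from assms[unfolded loop_homotopic] obtain h where
    h: "continuous_map (prod_topology I01 I01) X h"
    "\<And>x. x \<in> {0..1} \<Longrightarrow> h (0,x) = p x" "\<And>x. x \<in> {0..1} \<Longrightarrow> h (1,x) = q x"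
    "\<And>t. t \<in> {0..1} \<Longrightarrow> h (t,0) = b \<and> h (t,1) = b"
    by auto
  have "continuous_map (prod_topology I01 I01) (prod_topology I01 I01) (\<lambda>x. (fst x, 1 - snd x))"
    by (auto simp: prod_topology_subtopology_eu intro!: continuous_intros)
  from continuous_map_compose[OF this h(1)]
  have "continuous_map (prod_topology I01 I01) X (\<lambda>x. h (fst x, 1 - snd x))" by (simp add: o_def)
  then show ?thesis
    unfolding loop_homotopic using h
    by (intro exI[of _ "\<lambda>x. h (fst x, 1 - snd x)"]) auto
qed

lemma inv_word_append: "inv_word (u @ v) = inv_word v @ inv_word u"
  by (simp add: inv_word_def)

lemma inv_word_Cons: "inv_word ((g, b) # v) = inv_word v @ [(g, \<not> b)]"
  by (simp add: inv_word_def)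

lemma inv_word_Nil [simp]: "inv_word [] = []"
  by (simp add: inv_word_def)

lemma inv_word_inv_word [simp]: "inv_word (inv_word w) = w"
  by (simp add: inv_word_def rev_map case_prod_unfold o_def)

lemma fst_set_inv_word [simp]: "fst ` set (inv_word w) = fst ` set w"
  by (force simp: inv_word_def)

context free_faces
begin

text \<open>The relator \<open>U m @ [(m, \<sigma> m)]\<close> makes the letter
  \<open>(m, \<sigma> m)\<close> equal to the inverse of \<open>U m\<close>, and the opposite letter
  equal to \<open>U m\<close>.\<close>

definition subst :: "'g \<times> bool \<Rightarrow> ('g \<times> bool) list" where
  "subst l = (if fst l \<in> N then (if snd l = \<sigma> (fst l) then inv_word (U (fst l)) else U (fst l)) else [l])"

definition subst_word :: "('g \<times> bool) list \<Rightarrow> ('g \<times> bool) list" where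
  "subst_word w = concat (map subst w)"

lemma subst_word_append [simp]: "subst_word (u @ v) = subst_word u @ subst_word v"
  and subst_word_Nil [simp]: "subst_word [] = []"
  and subst_word_single [simp]: "subst_word [l] = subst l"
  by (simp_all add: subst_word_def)

lemma subst_word_inv_word: "subst_word (inv_word w) = inv_word (subst_word w)"
proof (induction w)
  case (Cons l w)
  obtain g b where l: "l = (g, b)" by (cases l)
  have "subst_word (l # w) = subst l @ subst_word w" by (simp add: subst_word_def)
  moreover have "subst (g, \<not> b) = inv_word (subst (g, b))"
    by (auto simp: subst_def inv_word_Cons)
  ultimately show ?case using Cons by (simp add: l inv_word_Cons inv_word_append)
qed simp

lemma subst_word_in:
  assumes "fst ` set w \<subseteq> G \<union> N"
  shows "fst ` set (subst_word w) \<subseteq> G"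
proof -
  have "fst ` set (subst l) \<subseteq> G" if "fst l \<in> G \<union> N" for l
    using that UG by (auto simp: subst_def)
  then show ?thesis using assms by (fastforce simp: subst_word_def)
qed

text \<open>The two arcs of the boundary of the disc m are homotopic by a straight line in the disc.\<close>
lemma free_letter_homotopic:
  assumes R: "words_in G' I' R" and N: "N \<subseteq> I'" and m: "m \<in> N"
  shows "loop_homotopic (cpx G' I' R) Base (word_path (U m)) (letter (m, \<not> \<sigma> m))"
  unfolding loop_homotopic
proof (intro exI conjI ballI)
  let ?n = "real (length (U m))"
  \<comment> \<open>One arc runs forward from parameter 0 to \<open>\<alpha> m\<close>, the other
    backward from 1. Both start at \<open>circ 0\<close> and end at
    \<open>circ (\<alpha> m)\<close>, so the segments joining them are constant there. The backward
    run along the free edge is why the letter has sign \<open>\<not> \<sigma> m\<close>.\<close>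
  let ?c = "\<lambda>p. (1 - fst p) *\<^sub>R circ (\<alpha> m * snd p) + fst p *\<^sub>R circ (1 - (1 - \<alpha> m) * snd p)"
  have "continuous_on ({0..1} \<times> {0..1}) ?c"
    by (intro continuous_intros continuous_on_compose2[OF continuous_on_circ[of UNIV]]) auto
  moreover have "?c p \<in> cball 0 1" if "p \<in> {0..1} \<times> {0..1}" for p
    using that by (intro convexD_alt[OF convex_cball]) auto
  ultimately have "continuous_map (prod_topology I01 I01) disc_top ?c"
    by (simp only: prod_topology_subtopology_eu continuous_map_subtopology_eu) (auto simp: Pi_iff)
  then show "continuous_map (prod_topology I01 I01) (cpx G' I' R) (dpt R m \<circ> ?c)"
    using R N m by (intro continuous_map_compose[OF _ continuous_map_dpt]) auto
  have n\<alpha>: "(?n + 1) * \<alpha> m = ?n" by (simp add: \<alpha>_def field_simps)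
  have base: "dpt R m (circ 0) = Base" "dpt R m (circ (\<alpha> m)) = Base"
    using dpt_circ[of 0 R m] dpt_free_edge[OF m, of "\<alpha> m"] \<alpha>_bounds[of m] n\<alpha>
    by (simp_all add: add.commute)
  fix x :: real assume x: "x \<in> {0..1}"
  have "0 \<le> \<alpha> m * x" "\<alpha> m * x \<le> \<alpha> m" using x \<alpha>_bounds(1)[of m] by (auto simp: mult_left_le)
  from dpt_arc[OF m this] show "(dpt R m \<circ> ?c) (0, x) = word_path (U m) x"
    by (cases "\<alpha> m = 0") (auto simp: \<alpha>_def)
  have "\<alpha> m \<le> 1 - (1 - \<alpha> m) * x" "1 - (1 - \<alpha> m) * x \<le> 1"
  proof -
    have "(1 - \<alpha> m) * x \<le> 1 - \<alpha> m" using x \<alpha>_bounds[of m] by (intro mult_left_le) auto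
    moreover have "0 \<le> (1 - \<alpha> m) * x" using x \<alpha>_bounds[of m] by (intro mult_nonneg_nonneg) auto
    ultimately show "\<alpha> m \<le> 1 - (1 - \<alpha> m) * x" "1 - (1 - \<alpha> m) * x \<le> 1" by linarith+
  qed
  note dpt_free_edge[OF m this]
  moreover have "(?n + 1) * (1 - (1 - \<alpha> m) * x) - ?n = 1 - x"
  proof -
    have "(?n + 1) * (1 - \<alpha> m) = 1" using n\<alpha> by (simp add: right_diff_distrib)
    moreover have "(?n + 1) * (1 - (1 - \<alpha> m) * x) = ?n + 1 - ((?n + 1) * (1 - \<alpha> m)) * x"
      by (subst right_diff_distrib) (simp only: mult_1_right mult.assoc)
    ultimately show ?thesis by simp
  qed
  ultimately show "(dpt R m \<circ> ?c) (1, x) = letter (m, \<not> \<sigma> m) x"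
    by (simp add: letter_inverse add.commute)
  have "(1 - x) *\<^sub>R p + x *\<^sub>R p = p" for p :: "real \<times> real"
    by (simp add: algebra_simps)
  then show "(dpt R m \<circ> ?c) (x, 0) = Base" "(dpt R m \<circ> ?c) (x, 1) = Base"
    using base by simp_all
qed

lemma subst_homotopic:
  assumes R: "words_in G' I' R" and N: "N \<subseteq> I'" and l: "fst l \<in> G'"
  shows "loop_homotopic (cpx G' I' R) Base (letter l) (word_path (subst l))"
proof -
  obtain g b where gb: "l = (g, b)" by (cases l)
  have refl: "loop_homotopic (cpx G' I' R) Base (letter l) (letter l)"
    using continuous_map_letter[OF R l] by (intro loop_homotopic_eqI) auto
  show ?thesis
  proof (cases "g \<in> N")
    case False
    then show ?thesis
      using continuous_map_letter[OF R l] gb by (intro loop_homotopic_eqI) (auto simp: subst_def word_path_single)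
  next
    case g: True
    note * = loop_homotopic_sym[OF free_letter_homotopic[OF R N g]]
    show ?thesis
    proof (cases "b = \<sigma> g")
      case False
      then show ?thesis using * g gb by (simp add: subst_def)
    next
      case True
      have "loop_homotopic (cpx G' I' R) Base (letter l) (\<lambda>s. letter (g, \<not> \<sigma> g) (1 - s))"
        using refl by (simp add: letter_inverse gb True)
      also have "loop_homotopic (cpx G' I' R) Base \<dots> (\<lambda>s. word_path (U g) (1 - s))"
        using * by (rule loop_homotopic_reverse)
      also have "loop_homotopic (cpx G' I' R) Base \<dots> (word_path (inv_word (U g)))"
        using loop_homotopicD[OF loop_homotopic_reverse[OF *]]
        by (intro loop_homotopic_eqI) (auto simp: word_path_inv_word)
      finally show ?thesis using True g gb by (simp add: subst_def)
    qed
  qed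
qed

text \<open>In the use of \<open>attach_discs_homotopic\<close> the discs of N stay fixed and those
  of I move, across them, to words over G. The resulting family \<open>R'\<close> still agrees with
  R on N, so it satisfies the locale assumptions, and now no relator in I runs over an edge of
  N.\<close>

theorem eliminate_generators:
  assumes R: "words_in (G \<union> N) I R"
  shows "cpx (G \<union> N) (I \<union> N) R homotopy_equivalent_space cpx G I (\<lambda>i. subst_word (R i))"
proof -
  define R' where "R' i = (if i \<in> N then R i else subst_word (R i))" for i
  have RN': "words_in (G \<union> N) N R" using RN UG by (fastforce simp: words_in_def)
  have all: "words_in (G \<union> N) (N \<union> I) R" using R RN' by (auto simp: words_in_def)
  have sub: "words_in G I (\<lambda>i. subst_word (R i))"
    using R subst_word_in by (auto simp: words_in_def)
  have R'G: "words_in G I R'" using sub IN by (auto simp: words_in_def R'_def)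
  have all': "words_in (G \<union> N) (N \<union> I) R'"
    using RN' R'G IN by (fastforce simp: words_in_def R'_def)
  have "cpx (G \<union> N) (N \<union> I) R homotopy_equivalent_space cpx (G \<union> N) (N \<union> I) R'"
  proof (rule attach_discs_homotopic[OF all all'])
    fix m assume m: "m \<in> I"
    have "loop_homotopic (cpx (G \<union> N) N R) Base (word_path (R m)) (word_path (concat (map subst (R m))))"
    proof (rule word_path_subst_homotopic)
      fix l assume "l \<in> set (R m)"
      then have l: "fst l \<in> G \<union> N" using R m by (auto simp: words_in_def)
      show "loop_homotopic (cpx (G \<union> N) N R) Base (letter l) (word_path (subst l))"
        using subst_homotopic[OF RN' _ l] by simp
      fix k assume "k \<in> set (subst l)"
      then have "fst k \<in> G \<union> N"
        using subst_word_in[of "[l]"] l by (auto simp: image_subset_iff)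
      then show "continuous_map I01 (cpx (G \<union> N) N R) (letter k)"
        by (rule continuous_map_letter[OF RN'])
    qed (use RN' in \<open>simp add: topspace_cpx\<close>)
    then show "freely_homotopic (cpx (G \<union> N) N R) (dpt R m) (dpt R' m)"
      using m IN by (intro freely_homotopic_if_loop_homotopic) (auto simp: R'_def subst_word_def)
  qed (use IN in \<open>auto simp: R'_def\<close>)
  also have "cpx (G \<union> N) (N \<union> I) R' homotopy_equivalent_space cpx G I R'"
  proof -
    interpret R': free_faces G I N R' U \<sigma>
      using GN IN RN UG by unfold_locales (auto simp: R'_def)
    show ?thesis using R'.collapse_free_faces[OF R'G] by (simp add: Un_commute)
  qed
  also have "cpx G I R' = cpx G I (\<lambda>i. subst_word (R i))"
    using IN by (intro cpx_cong) (auto simp: R'_def)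
  finally show ?thesis by (simp add: Un_commute)
qed

end

section \<open>Comparison with the complexes of the definitions\<close>

lemma openin_quotient_topology:
  "openin (quotient_topology X f) U \<longleftrightarrow> U \<subseteq> f ` topspace X \<and> openin X {x \<in> topspace X. f x \<in> U}"
proof -
  have "istopology (\<lambda>U. U \<subseteq> f ` topspace X \<and> openin X {x \<in> topspace X. f x \<in> U})" (is "istopology ?P")
    unfolding istopology_def
  proof (rule conjI; intro allI impI)
    fix U V assume UV: "?P U" "?P V"
    have eq: "{x \<in> topspace X. f x \<in> U \<inter> V} = {x \<in> topspace X. f x \<in> U} \<inter> {x \<in> topspace X. f x \<in> V}"
      by auto
    show "?P (U \<inter> V)" unfolding eq using UV by (intro conjI openin_Int) auto
  next
    fix K assume K: "\<forall>U\<in>K. ?P U"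
    have eq: "{x \<in> topspace X. f x \<in> \<Union>K} = \<Union>((\<lambda>U. {x \<in> topspace X. f x \<in> U}) ` K)" by auto
    show "?P (\<Union>K)" unfolding eq using K by (intro conjI openin_Union) auto
  qed
  then show ?thesis by (simp add: quotient_topology_def)
qed

lemma topspace_quotient_topology: "topspace (quotient_topology X f) = f ` topspace X"
proof -
  have "{x \<in> topspace X. f x \<in> f ` topspace X} = topspace X" by auto
  then have "openin (quotient_topology X f) (f ` topspace X)" by (simp add: openin_quotient_topology)
  then show ?thesis
    by (metis openin_quotient_topology openin_subset openin_topspace subset_antisym)
qed

text \<open>This replaces representatives in nat x R^2 by normal forms with names of any type.
  Generators and relators are renamed by separate bijections, so a list of relators may be matched
  with an index set in any order.\<close>

lemma pres_complex_homeomorphic_cpx: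
  fixes f h :: "nat \<Rightarrow> 'g"
  assumes f: "bij_betw f {..<n} G" and h: "bij_betw h {..<length R} I"
    and R: "\<And>i. i < length R \<Longrightarrow> fst ` set (R ! i) \<subseteq> {..<n}"
    and Q: "\<And>i. i < length R \<Longrightarrow> Q (h i) = map (\<lambda>(g, b). (f g, b)) (R ! i)"
  shows "pres_complex n R homeomorphic_space cpx G I Q"
proof -
  define X where "X = sum_topology (cell_space n) {0..n + length R}"
  define q where "q = ident n R"
  define \<theta> :: "nat \<times> (real \<times> real) \<Rightarrow> 'g pt" where
    "\<theta> = (\<lambda>(i, z). if i = 0 then Base else if i \<le> n then Edge (f (i - 1)) (fst z) else Disc (h (i - Suc n)) z)"
  have fG: "f g \<in> G" if "g < n" for g using f that by (auto simp: bij_betw_def)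
  have hI: "h i \<in> I" if "i < length R" for i using h that by (auto simp: bij_betw_def)
  have Gf: "\<exists>k<n. g = f k" if "g \<in> G" for g using f that by (auto simp: bij_betw_def)
  have Ih: "\<exists>k<length R. i = h k" if "i \<in> I" for i using h that by (auto simp: bij_betw_def)
  have wQ: "words_in G I Q"
    unfolding words_in_def
  proof
    fix i assume "i \<in> I"
    then obtain k where k: "k < length R" "i = h k" using Ih by blast
    show "fst ` set (Q i) \<subseteq> G"
      using R[OF k(1)] fG unfolding k(2) Q[OF k(1)] by (auto simp: image_subset_iff)
  qed
  have \<theta>e: "\<theta> (edge_pt g t) = ept (f g) t" if "g < n" for g t
    using that by (simp add: \<theta>_def edge_pt_def ept_def base_pt_def)
  have \<theta>a: "\<theta> (attach w s) = word_path (map (\<lambda>(g, b). (f g, b)) w) s"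
    if w: "fst ` set w \<subseteq> {..<n}" and s: "s \<in> {0..<1}" for w s
  proof (cases "w = []")
    case False
    define j where "j = nat \<lfloor>real (length w) * s\<rfloor>"
    have "real (length w) * s < real (length w) * 1" using False s by (intro mult_strict_left_mono) auto
    moreover have "0 \<le> real (length w) * s" using s by simp
    ultimately have j: "j < length w" unfolding j_def by linarith
    obtain g b where gb: "w ! j = (g, b)" by (cases "w ! j")
    have "g < n" using w j gb by (metis fst_conv image_subset_iff lessThan_iff nth_mem)
    then show ?thesis
      using False s j gb \<theta>e by (simp add: attach_def word_path_def Let_def letter_def flip: j_def)
  qed (simp add: attach_def \<theta>_def base_pt_def)
  have top0: "{z. (0, z) \<in> topspace X} = {(0,0)}"
    by (auto simp: X_def cell_space_def)
  have tope: "(Suc g, z) \<in> topspace X \<longleftrightarrow> z \<in> {0..1} \<times> {0}" if "g < n" for g z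
    using that by (auto simp: X_def cell_space_def)
  have topd: "(Suc n + i, z) \<in> topspace X \<longleftrightarrow> norm z \<le> 1" if "i < length R" for i z
    using that by (auto simp: X_def cell_space_def)
  have q0: "\<theta> (q (0, z)) = Base" for z
    by (simp add: q_def ident_def \<theta>_def base_pt_def)
  have qe: "\<theta> (q (Suc g, z)) = ept (f g) (fst z)" if "g < n" for g z
    using that \<theta>e by (simp add: q_def ident_def)
  have qd: "\<theta> (q (Suc n + i, z)) = dpt Q (h i) z" if "i < length R" for i z
    using \<theta>a[OF R[OF that] circ_param(1)] by (auto simp: q_def ident_def dpt_def Q[OF that]) (auto simp: \<theta>_def)
  have Xcases: "P x" if "x \<in> topspace X" "P (0, (0,0))"
      "\<And>g t. g < n \<Longrightarrow> t \<in> {0..1} \<Longrightarrow> P (Suc g, (t, 0))"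
      "\<And>i z. i < length R \<Longrightarrow> norm z \<le> 1 \<Longrightarrow> P (Suc n + i, z)" for P x
  proof -
    obtain i z where x: "x = (i, z)" by (cases x)
    have i: "i \<le> n + length R" "z \<in> topspace (cell_space n i)" using that(1) by (auto simp: X_def x)
    consider "i = 0" | g where "i = Suc g" "g < n" | k where "i = Suc n + k" "k < length R"
    proof (cases "i \<le> n")
      case True
      then show ?thesis using that by (cases i) auto
    next
      case False
      then show ?thesis using that(3)[of "i - Suc n"] i by auto
    qed
    then show ?thesis using that i by cases (auto simp: x cell_space_def)
  qed
  have "quotient_map (quotient_topology X q) (cpx G I Q) \<theta>"
    unfolding quotient_map_def
  proof (intro conjI allI impI)
    show "\<theta> ` topspace (quotient_topology X q) = topspace (cpx G I Q)"
      unfolding topspace_quotient_topology topspace_cpx[OF wQ] image_image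
    proof (intro equalityI subsetI)
      fix y assume "y \<in> (\<lambda>x. \<theta> (q x)) ` topspace X"
      then obtain x where "x \<in> topspace X" "y = \<theta> (q x)" by auto
      moreover have "\<theta> (q x) \<in> cells G I" if "x \<in> topspace X" for x
        by (rule Xcases[OF that]) (simp_all add: q0 qe qd ept_in_cells fG hI dpt_in_cells[OF wQ] del: add_Suc)
      ultimately show "y \<in> cells G I" by simp
    next
      fix y assume "y \<in> cells G I"
      then consider "y = Base" | g t where "g \<in> G" "0 < t" "t < 1" "y = Edge g t"
        | i z where "i \<in> I" "norm z < 1" "y = Disc i z"
        unfolding cells_def by blast
      then show "y \<in> (\<lambda>x. \<theta> (q x)) ` topspace X"
      proof cases
        case 1
        then show ?thesis using q0[of "(0,0)"] top0 by (intro image_eqI[of _ _ "(0,(0,0))"]) auto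
      next
        case 2
        then obtain k where k: "k < n" "g = f k" using Gf by blast
        then show ?thesis
          using qe[of k "(t,0)"] tope[of k "(t,0)"] 2
          by (intro image_eqI[of _ _ "(Suc k,(t,0))"]) (auto simp: ept_def)
      next
        case 3
        then obtain k where k: "k < length R" "i = h k" using Ih by blast
        then show ?thesis
          using qd[of k z] topd[of k z] 3
          by (intro image_eqI[of _ _ "(Suc n + k,z)"]) (auto simp: dpt_def)
      qed
    qed
    fix U assume U: "U \<subseteq> topspace (cpx G I Q)"
    let ?W = "{x \<in> topspace X. \<theta> (q x) \<in> U}"
    have "openin (quotient_topology X q) {x \<in> topspace (quotient_topology X q). \<theta> x \<in> U} \<longleftrightarrow> openin X ?W"
    proof -
      have "{x \<in> topspace X. q x \<in> {x \<in> topspace (quotient_topology X q). \<theta> x \<in> U}} = ?W"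
        by (auto simp: topspace_quotient_topology)
      then show ?thesis by (auto simp: openin_quotient_topology topspace_quotient_topology)
    qed
    also have "\<dots> \<longleftrightarrow> (\<forall>i\<in>{0..n + length R}. openin (cell_space n i) {z. (i, z) \<in> ?W})"
      unfolding X_def by (subst openin_sum_topology) auto
    also have "\<dots> \<longleftrightarrow> (\<forall>g<n. openin (cell_space n (Suc g)) {z. (Suc g, z) \<in> ?W}) \<and>
        (\<forall>i<length R. openin (cell_space n (Suc n + i)) {z. (Suc n + i, z) \<in> ?W})" (is "?l \<longleftrightarrow> ?r")
    proof
      assume ?r
      show ?l
      proof
        fix i assume i: "i \<in> {0..n + length R}"
        consider "i = 0" | g where "i = Suc g" "g < n" | k where "i = Suc n + k" "k < length R"
        proof (cases "i \<le> n")
          case True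
          then show ?thesis using that by (cases i) auto
        next
          case False
          then show ?thesis using that(3)[of "i - Suc n"] i by auto
        qed
        then show "openin (cell_space n i) {z. (i, z) \<in> ?W}"
        proof cases
          case 1
          \<comment> \<open>The 0-cell is a single point, so the preimage in it is empty or
            everything and thus always open; \<open>openin_cpx\<close> accordingly has no clause for
            \<open>Base\<close>.\<close>
          have "{z. (0, z) \<in> ?W} \<subseteq> {z. (0, z) \<in> topspace X}" by auto
          then have "{z. (0, z) \<in> ?W} = {} \<or> {z. (0, z) \<in> ?W} = {(0,0)}"
            unfolding top0 by (rule subset_singletonD)
          moreover have "topspace (cell_space n 0) = {(0,0)}" by (simp add: cell_space_def)
          then have "openin (cell_space n 0) {(0,0)}" using openin_topspace[of "cell_space n 0"] by simp
          ultimately have "openin (cell_space n 0) {z. (0, z) \<in> ?W}"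
            by (elim disjE; simp only: openin_empty)
          then show ?thesis by (simp only: 1)
        qed (use \<open>?r\<close> in blast)+
      qed
    qed auto
    also have "\<dots> \<longleftrightarrow> (\<forall>g<n. openin I01 {t \<in> {0..1}. ept (f g) t \<in> U}) \<and>
        (\<forall>i<length R. openin disc_top {z \<in> cball 0 1. dpt Q (h i) z \<in> U})"
    proof -
      have "openin (cell_space n (Suc g)) {z. (Suc g, z) \<in> ?W} \<longleftrightarrow> openin I01 {t \<in> {0..1}. ept (f g) t \<in> U}"
        if g: "g < n" for g
      proof -
        have hm: "homeomorphic_map I01 (top_of_set ({0..1} \<times> {0::real})) (\<lambda>t. (t, 0::real))"
          unfolding homeomorphic_map_maps homeomorphic_maps_def
          by (intro exI[of _ fst]) (auto intro!: continuous_intros)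
        have "{z. (Suc g, z) \<in> ?W} = (\<lambda>t. (t, 0)) ` {t \<in> {0..1}. ept (f g) t \<in> U}"
          using g tope[OF g] qe[OF g] by auto
        moreover have "cell_space n (Suc g) = top_of_set ({0..1} \<times> {0})" using g by (simp add: cell_space_def)
        moreover have "{t \<in> {0..1}. ept (f g) t \<in> U} \<subseteq> topspace I01" by auto
        ultimately show ?thesis
          by (simp only: homeomorphic_map_openness[OF hm])
      qed
      moreover have "openin (cell_space n (Suc n + i)) {z. (Suc n + i, z) \<in> ?W} \<longleftrightarrow>
          openin disc_top {z \<in> cball 0 1. dpt Q (h i) z \<in> U}" if i: "i < length R" for i
      proof -
        have "{z. (Suc n + i, z) \<in> ?W} = {z \<in> cball 0 1. dpt Q (h i) z \<in> U}"
          using topd[OF i] qd[OF i] by auto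
        moreover have "cell_space n (Suc n + i) = disc_top" by (simp add: cell_space_def)
        ultimately show ?thesis by simp
      qed
      ultimately show ?thesis by simp
    qed
    also have "\<dots> \<longleftrightarrow> openin (cpx G I Q) U"
    proof -
      have "G = f ` {..<n}" "I = h ` {..<length R}"
        using f h by (simp_all add: bij_betw_def)
      then have "(\<forall>g\<in>G. A g) \<longleftrightarrow> (\<forall>k<n. A (f k))" "(\<forall>i\<in>I. A i) \<longleftrightarrow> (\<forall>k<length R. A (h k))" for A
        by auto
      then show ?thesis using U unfolding openin_cpx topspace_cpx[OF wQ] by simp
    qed
    finally show "openin (quotient_topology X q) {x \<in> topspace (quotient_topology X q). \<theta> x \<in> U} = openin (cpx G I Q) U" .
  qed
  moreover have "inj_on \<theta> (topspace (quotient_topology X q))"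
  proof -
    \<comment> \<open>\<open>\<theta>\<close> forgets coordinates on the 0-cell and the 1-cells, so
      injectivity depends on the shapes that canonical representatives can have.\<close>
    have norm: "q x = base_pt \<or> (\<exists>g t. g < n \<and> t \<noteq> 0 \<and> t \<noteq> 1 \<and> q x = (Suc g, (t, 0))) \<or>
        (\<exists>i z. i < length R \<and> q x = (Suc n + i, z))" if "x \<in> topspace X" for x
    proof -
      have e: "edge_pt g t = base_pt \<or> (t \<noteq> 0 \<and> t \<noteq> 1 \<and> edge_pt g t = (Suc g, (t, 0)))" for g t
        by (auto simp: edge_pt_def)
      show ?thesis
      proof (rule Xcases[OF that])
        fix i and z :: "real \<times> real" assume i: "i < length R" "norm z \<le> 1"
        show "q (Suc n + i, z) = base_pt \<or> (\<exists>g t. g < n \<and> t \<noteq> 0 \<and> t \<noteq> 1 \<and> q (Suc n + i, z) = (Suc g, (t, 0))) \<or>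
          (\<exists>k y. k < length R \<and> q (Suc n + i, z) = (Suc n + k, y))"
        proof (cases "norm z = 1 \<and> R ! i \<noteq> []")
          case True
          define s where "s = circ_param z"
          define j where "j = nat \<lfloor>real (length (R ! i)) * s\<rfloor>"
          have s: "s \<in> {0..<1}" using circ_param(1) True by (auto simp: s_def)
          have "real (length (R ! i)) * s < real (length (R ! i)) * 1"
            using True s by (intro mult_strict_left_mono) auto
          moreover have "0 \<le> real (length (R ! i)) * s" using s by simp
          ultimately have j: "j < length (R ! i)" unfolding j_def by linarith
          obtain g b where gb: "R ! i ! j = (g, b)" by (cases "R ! i ! j")
          have g: "g < n" using R[OF i(1)] j gb by (metis fst_conv image_subset_iff lessThan_iff nth_mem)
          have "\<exists>t. q (Suc n + i, z) = edge_pt g t"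
            using True gb by (auto simp: q_def ident_def attach_def Let_def j_def s_def)
          then show ?thesis using e g by metis
        next
          case False
          then show ?thesis using i by (auto simp: q_def ident_def attach_def)
        qed
      next
        fix g t assume "g < n"
        then have "q (Suc g, (t, 0)) = edge_pt g t" by (simp add: q_def ident_def)
        then show "q (Suc g, (t, 0)) = base_pt \<or>
          (\<exists>k s. k < n \<and> s \<noteq> 0 \<and> s \<noteq> 1 \<and> q (Suc g, (t, 0)) = (Suc k, (s, 0))) \<or>
          (\<exists>i z. i < length R \<and> q (Suc g, (t, 0)) = (Suc n + i, z))"
          using e[of g t] \<open>g < n\<close> by metis
      qed (simp add: q_def ident_def)
    qed
    show ?thesis
      unfolding topspace_quotient_topology
    proof (rule inj_onI)
      fix x y assume xy: "x \<in> q ` topspace X" "y \<in> q ` topspace X" "\<theta> x = \<theta> y"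
      have *: "x = base_pt \<or> (\<exists>g t. g < n \<and> t \<noteq> 0 \<and> t \<noteq> 1 \<and> x = (Suc g, (t, 0))) \<or>
        (\<exists>i z. i < length R \<and> x = (Suc n + i, z))" if xq: "x \<in> q ` topspace X" for x
      proof -
        obtain p where "p \<in> topspace X" "x = q p" using xq by blast
        then show ?thesis using norm[of p] by simp
      qed
      have finj: "f g = f g' \<longleftrightarrow> g = g'" if "g < n" "g' < n" for g g'
        using that f by (auto simp: bij_betw_def inj_on_def)
      have hinj: "h g = h g' \<longleftrightarrow> g = g'" if "g < length R" "g' < length R" for g g'
        using that h by (auto simp: bij_betw_def inj_on_def)
      show "x = y"
        using *[OF xy(1)] *[OF xy(2)] xy(3) by (auto simp: \<theta>_def base_pt_def finj hinj)
    qed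
  qed
  ultimately have "homeomorphic_map (quotient_topology X q) (cpx G I Q) \<theta>"
    by (simp add: homeomorphic_map_def)
  then show ?thesis
    unfolding pres_complex_def X_def q_def using homeomorphic_map_imp_homeomorphic_space by blast
qed

section \<open>Cyclic presentations\<close>

lemma winv_eq_inv_word: "winv w = inv_word w"
  by (simp add: winv_def inv_word_def)

text \<open>The Boolean keeps the two families of generators apart in a common complex:
  \<open>False\<close> marks the x and \<open>True\<close> marks the y.\<close>

definition tag :: "bool \<Rightarrow> word \<Rightarrow> ((bool \<times> nat) \<times> bool) list" where
  "tag b w = map (\<lambda>(g, s). ((b, g), s)) w"

lemma tag_append [simp]: "tag b (u @ v) = tag b u @ tag b v"
  and tag_Nil [simp]: "tag b [] = []"
  by (simp_all add: tag_def)

lemma tag_winv: "tag b (winv w) = inv_word (tag b w)"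
  by (simp add: tag_def winv_def inv_word_def rev_map case_prod_unfold o_def)

lemma in_set_tag [simp]: "((c, g), s) \<in> set (tag b w) \<longleftrightarrow> c = b \<and> (g, s) \<in> set w"
  by (force simp: tag_def)

lemma fst_set_tag: "fst ` set (tag b w) = Pair b ` fst ` set w"
  by (force simp: tag_def)

lemma shift_append: "shift n j (u @ v) = shift n j u @ shift n j v"
  by (simp add: shift_def)

lemma shift_concat: "shift n j (concat ws) = concat (map (shift n j) ws)"
  by (induction ws) (simp_all add: shift_def)

lemma shift_winv: "shift n j (winv w) = winv (shift n j w)"
  by (simp add: shift_def winv_def rev_map case_prod_unfold o_def)

lemma shift_wpow: "shift n j (wpow w e) = wpow (shift n j w) e"
  by (simp add: wpow_def shift_concat shift_winv)

lemma shift_gen: "0 < n \<Longrightarrow> shift n j (gen n i) = gen n (i + int j)"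
proof -
  assume n: "0 < n"
  have "(nat ((i - 1) mod int n) + j) mod n = nat ((i + int j - 1) mod int n)"
  proof -
    have "int ((nat ((i - 1) mod int n) + j) mod n) = ((i - 1) mod int n + int j) mod int n"
      using n by (simp add: zmod_int)
    also have "\<dots> = (i + int j - 1) mod int n"
      using mod_add_left_eq[of "i - 1" "int n" "int j"] by (simp add: algebra_simps)
    finally show ?thesis using nat_int by metis
  qed
  then show ?thesis by (simp add: shift_def gen_def)
qed

lemma shift_xpow: "0 < n \<Longrightarrow> shift n j (xpow n i e) = xpow n (i + int j) e"
  by (simp add: xpow_def shift_wpow shift_gen)

lemma gen_cong: "i mod int n = i' mod int n \<Longrightarrow> gen n i = gen n i'"
  unfolding gen_def by (metis mod_diff_left_eq)

lemma xpow_cong: "i mod int n = i' mod int n \<Longrightarrow> xpow n i e = xpow n i' e"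
  unfolding xpow_def using gen_cong by metis

lemma fst_set_wpow: "fst ` set (wpow w e) \<subseteq> fst ` set w"
  by (auto simp: wpow_def winv_eq_inv_word split: if_splits)

lemma fst_set_xpow: "0 < n \<Longrightarrow> fst ` set (xpow n i e) \<subseteq> {..<n}"
  using fst_set_wpow[of "gen n i" e] by (auto simp: xpow_def gen_def nat_less_iff)

lemma wpow_1 [simp]: "wpow w 1 = w" and wpow_minus_1 [simp]: "wpow w (-1) = winv w"
  by (simp_all add: wpow_def)

lemma bij_betw_rotate:
  assumes "0 < n"
  shows "bij_betw (\<lambda>j. (b, nat ((e + int j) mod int n))) {..<n} ({b} \<times> {..<n})"
proof (rule bij_betwI')
  fix x y assume xy: "x \<in> {..<n}" "y \<in> {..<n}"
  have "x = y" if "(e + int x) mod int n = (e + int y) mod int n"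
  proof -
    have "(e + int x - e) mod int n = (e + int y - e) mod int n"
      using that by (metis mod_diff_left_eq)
    then show ?thesis using xy by simp
  qed
  then show "((b, nat ((e + int x) mod int n)) = (b, nat ((e + int y) mod int n))) = (x = y)"
    using assms by (auto simp: eq_nat_nat_iff)
next
  fix y assume "y \<in> {b} \<times> {..<n}"
  then obtain g where g: "y = (b, g)" "g < n" by auto
  have "(e + int (nat ((int g - e) mod int n))) mod int n = int g"
    using assms g by (simp add: mod_add_right_eq)
  moreover have "nat ((int g - e) mod int n) < n" using assms by (simp add: nat_less_iff)
  ultimately show "\<exists>x\<in>{..<n}. y = (b, nat ((e + int x) mod int n))"
    using g by (intro bexI[of _ "nat ((int g - e) mod int n)"]) auto
qed (use assms in \<open>auto simp: nat_less_iff\<close>)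

text \<open>\<open>\<rho> i\<close> is the relator with starting subscript i. The n shifts run once
  through all residues, so every start c gives the same relators, and e can be chosen to store each
  relator under the generator for which it will be solved.\<close>

lemma cyclic_complex:
  assumes n: "0 < n" and \<rho>: "\<And>i i'. i mod int n = i' mod int n \<Longrightarrow> \<rho> i = \<rho> i'"
    and s: "\<And>j. shift n j (\<rho> c) = \<rho> (c + int j)"
    and w: "\<And>i. fst ` set (\<rho> i) \<subseteq> {..<n}"
    and Q: "\<And>g. Q (b, g) = tag b (\<rho> (int g + e))"
  shows "pres_complex n (cyclic_rels n (\<rho> c)) homeomorphic_space cpx ({b} \<times> {..<n}) ({b} \<times> {..<n}) Q"
proof (rule pres_complex_homeomorphic_cpx)
  \<comment> \<open>Entry j of the list is \<open>\<rho> (c + int j)\<close>, which \<open>Q\<close>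
    keeps at the g with g + e congruent to c + j.\<close>
  let ?h = "\<lambda>j. (b, nat ((c - e + int j) mod int n))"
  have len: "length (cyclic_rels n (\<rho> c)) = n" by (simp add: cyclic_rels_def)
  show "bij_betw (Pair b) {..<n} ({b} \<times> {..<n})" by (auto simp: bij_betw_def inj_on_def)
  show "bij_betw ?h {..<length (cyclic_rels n (\<rho> c))} ({b} \<times> {..<n})"
    unfolding len by (rule bij_betw_rotate[OF n])
  fix j assume "j < length (cyclic_rels n (\<rho> c))"
  then have j: "cyclic_rels n (\<rho> c) ! j = \<rho> (c + int j)"
    by (simp add: cyclic_rels_def s)
  show "fst ` set (cyclic_rels n (\<rho> c) ! j) \<subseteq> {..<n}" unfolding j by (rule w)
  have "(int (nat ((c - e + int j) mod int n)) + e) mod int n = (c + int j) mod int n"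
    using n by (simp add: mod_add_left_eq)
  from \<rho>[OF this] show "Q (?h j) = map (\<lambda>(g, s). ((b, g), s)) (cyclic_rels n (\<rho> c) ! j)"
    unfolding j Q by (simp add: tag_def)
qed

text \<open>In the complex with generators x and y and relators W(y) y^-1 and
  y_(i+k)^-1 y_i x_(i+m), either family of generators can be eliminated.\<close>
lemma cyc_hequiv_eliminate:
  fixes n r :: nat and k m c d :: int and Q \<epsilon> :: "nat \<Rightarrow> int"
  assumes n: "0 < n"
  defines "W \<equiv> \<lambda>i. concat (map (\<lambda>j. xpow n (i + Q j) (\<epsilon> j)) [0..<r])"
  defines "V \<equiv> \<lambda>i. concat (map (\<lambda>j. wpow (xpow n (i + Q j) (-1) @ xpow n (i + Q j + k) 1) (\<epsilon> j)) [0..<r])"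
  shows "cyc_hequiv n (W c @ xpow n (c + m) 1 @ winv (W (c + k))) (V d @ xpow n (d + m) (-1))"
proof -
  define X where "X = {False} \<times> {..<n}"
  define Y where "Y = {True} \<times> {..<n}"
  define \<rho> where "\<rho> i = W i @ xpow n (i + m) 1 @ winv (W (i + k))" for i
  \<comment> \<open>The cyclic permutation that puts x_(i+m) last. The two blocks before it are what
    y_(i+k)^-1 and y_i become on elimination of the y.\<close>
  define \<rho>' where "\<rho>' i = winv (W (i + k)) @ W i @ xpow n (i + m) 1" for i
  define \<tau> where "\<tau> i = V i @ xpow n (i + m) (-1)" for i
  define a where "a i = nat ((i - 1) mod int n)" for i
  define A where "A v = tag False (W (int (snd v) + 1))" for v :: "bool \<times> nat"
  \<comment> \<open>In y_(i+k)^-1 y_i x_(i+m) the generator of v is x_(i+m). Its subscript, counted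
    from 1, is \<open>int (snd v) + 1\<close>, so i is this number minus m.\<close>
  define B where "B v = tag True (xpow n (int (snd v) + 1 - m + k) (-1) @ xpow n (int (snd v) + 1 - m) 1)"
    for v :: "bool \<times> nat"
  define R where "R v = (if fst v then A v @ [(v, False)] else B v @ [(v, True)])" for v
  have a: "a i < n" "(int (a i) + 1) mod int n = i mod int n" for i
  proof -
    show "a i < n" using n by (simp add: a_def nat_less_iff)
    have "int (a i) = (i - 1) mod int n" using n by (simp add: a_def)
    then show "(int (a i) + 1) mod int n = i mod int n" by (simp add: mod_add_left_eq)
  qed
  have a': "(int (a i) + 1 + e) mod int n = (i + e) mod int n" for i e
    using a(2)[of i] by (metis mod_add_left_eq)
  have ag: "a (int g + 1) = g" if "g < n" for g using that by (simp add: a_def)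
  have gen: "gen n i = [(a i, True)]" for i by (simp add: gen_def a_def)
  have xpow1: "xpow n i 1 = gen n i" "xpow n i (-1) = winv (gen n i)" for i by (simp_all add: xpow_def)
  have shW: "shift n j (W i) = W (i + int j)" for i j
    using n by (simp add: W_def shift_concat shift_xpow o_def algebra_simps)
  have shV: "shift n j (V i) = V (i + int j)" for i j
    using n by (simp add: V_def shift_concat shift_wpow shift_append shift_xpow o_def algebra_simps)
  have xc: "xpow n (i + e) f = xpow n (i' + e) f" if "i mod int n = i' mod int n" for i i' e f
    using that by (intro xpow_cong) (metis mod_add_left_eq)
  have Wc: "W (i + e) = W (i' + e)" if "i mod int n = i' mod int n" for i i' e
    using xc[OF that, of "e + _"] by (simp add: W_def add.assoc)
  have Vc: "V i = V i'" if "i mod int n = i' mod int n" for i i'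
    using xc[OF that] by (simp add: V_def add.assoc)
  have Wn: "fst ` set (W i) \<subseteq> {..<n}" for i
    unfolding W_def using fst_set_xpow[OF n] by (auto simp: image_subset_iff)
  have Vn: "fst ` set (V i) \<subseteq> {..<n}" for i
  proof -
    have "fst ` set (wpow (xpow n e (-1) @ xpow n e' 1) f) \<subseteq> {..<n}" for e e' f
      using fst_set_wpow[of "xpow n e (-1) @ xpow n e' 1" f] fst_set_xpow[OF n, of e "-1"]
        fst_set_xpow[OF n, of e' 1] by (simp add: image_Un) blast
    then show ?thesis unfolding V_def by (auto simp: image_subset_iff)
  qed
  have xn: "g < n" if "(g, s) \<in> set (xpow n i e)" for g s i e
    using that fst_set_xpow[OF n, of i e] by force
  have Wn': "g < n" if "(g, s) \<in> set (W i)" for g s i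
    using that Wn[of i] by force
  have A: "fst ` set (A v) \<subseteq> X" and B: "fst ` set (B v) \<subseteq> Y" for v
    using Wn' xn by (auto simp: A_def B_def X_def Y_def)
  have XY: "X \<inter> Y = {}" "Y \<inter> X = {}" by (auto simp: X_def Y_def)
  \<comment> \<open>The same \<open>R\<close> is read in two ways: its relators on Y are free faces
    for the y over the base X, and those on X are free faces for the x over the base Y.\<close>
  interpret fy: free_faces X X Y R A "\<lambda>_. False"
    by unfold_locales (rule XY A | force simp: Y_def R_def)+
  interpret fx: free_faces Y Y X R B "\<lambda>_. True"
    by unfold_locales (rule XY B | force simp: X_def R_def)+

  have RX: "words_in (X \<union> Y) X R"
    unfolding words_in_def
  proof
    fix v assume v: "v \<in> X"
    then have "R v = B v @ [(v, True)]" by (auto simp: R_def X_def)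
    then show "fst ` set (R v) \<subseteq> X \<union> Y" using B[of v] v by auto
  qed
  have RY: "words_in (Y \<union> X) Y R"
    unfolding words_in_def
  proof
    fix v assume v: "v \<in> Y"
    then have "R v = A v @ [(v, False)]" by (auto simp: R_def Y_def)
    then show "fst ` set (R v) \<subseteq> Y \<union> X" using A[of v] v by auto
  qed

  \<comment> \<open>The offset 1 - m stores the relator with starting subscript i under x_(i+m),
    which has number i + m - 1 modulo n when counted from 0.\<close>
  have "pres_complex n (cyclic_rels n (\<rho> c)) homeomorphic_space cpx X X (\<lambda>v. tag False (\<rho> (int (snd v) + (1 - m))))"
    unfolding X_def
  proof (rule cyclic_complex[OF n])
    show "\<rho> i = \<rho> i'" if "i mod int n = i' mod int n" for i i'
      using xc[OF that] Wc[OF that] Wc[OF that, of 0] by (simp add: \<rho>_def)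
    show "shift n j (\<rho> c) = \<rho> (c + int j)" for j
      using n by (simp add: \<rho>_def shift_append shift_xpow shift_winv shW algebra_simps)
    show "fst ` set (\<rho> i) \<subseteq> {..<n}" for i
      using Wn fst_set_xpow[OF n] by (simp add: \<rho>_def winv_eq_inv_word image_Un)
  qed simp
  then have "pres_complex n (cyclic_rels n (\<rho> c)) homotopy_equivalent_space
      cpx X X (\<lambda>v. tag False (\<rho> (int (snd v) + (1 - m))))"
    by (rule homeomorphic_imp_homotopy_equivalent_space)
  also have "cpx X X (\<lambda>v. tag False (\<rho> (int (snd v) + (1 - m)))) homotopy_equivalent_space
      cpx X X (\<lambda>v. tag False (\<rho>' (int (snd v) + (1 - m))))"
  proof -
    have w: "fst ` set (tag False (\<rho> i)) \<subseteq> X" "fst ` set (tag False (\<rho>' i)) \<subseteq> X" for i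
    proof -
      have "fst ` set (\<rho> i) \<subseteq> {..<n}" "fst ` set (\<rho>' i) \<subseteq> {..<n}"
        using Wn fst_set_xpow[OF n] by (simp_all add: \<rho>_def \<rho>'_def winv_eq_inv_word image_Un)
      then show "fst ` set (tag False (\<rho> i)) \<subseteq> X" "fst ` set (tag False (\<rho>' i)) \<subseteq> X"
        unfolding fst_set_tag X_def by blast+
    qed
    \<comment> \<open>The empty set says that no disc is held fixed: all relators are rotated at
      once, inside the one-skeleton.\<close>
    have "cpx X ({} \<union> X) (\<lambda>v. tag False (\<rho> (int (snd v) + (1 - m)))) homotopy_equivalent_space
      cpx X ({} \<union> X) (\<lambda>v. tag False (\<rho>' (int (snd v) + (1 - m))))"
    proof (rule attach_discs_homotopic)
      fix v
      show "freely_homotopic (cpx X {} (\<lambda>v. tag False (\<rho> (int (snd v) + (1 - m)))))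
          (dpt (\<lambda>v. tag False (\<rho> (int (snd v) + (1 - m)))) v) (dpt (\<lambda>v. tag False (\<rho>' (int (snd v) + (1 - m)))) v)"
      proof (rule freely_homotopic_rotate)
        let ?i = "int (snd v) + (1 - m)"
        show "tag False (\<rho> ?i) = tag False (W ?i @ xpow n (?i + m) 1) @ tag False (winv (W (?i + k)))"
          by (simp add: \<rho>_def)
        show "tag False (\<rho>' ?i) = tag False (winv (W (?i + k))) @ tag False (W ?i @ xpow n (?i + m) 1)"
          by (simp add: \<rho>'_def)
        show "fst ` set (tag False (W ?i @ xpow n (?i + m) 1) @ tag False (winv (W (?i + k)))) \<subseteq> X"
          using w(1)[of ?i] by (simp add: \<rho>_def Un_assoc image_Un)
      qed (simp add: words_in_def)
    qed (use w in \<open>auto simp: words_in_def\<close>)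
    then show ?thesis by simp
  qed
  also have "cpx X X (\<lambda>v. tag False (\<rho>' (int (snd v) + (1 - m)))) = cpx X X (\<lambda>v. fy.subst_word (R v))"
  proof (rule cpx_cong)
    fix v assume "v \<in> X"
    then obtain g where v: "v = (False, g)" "g < n" by (auto simp: X_def)
    let ?i = "int g + (1 - m)"
    have "R v = [((True, a (?i + k)), False), ((True, a ?i), True), (v, True)]"
      by (simp add: R_def v B_def xpow1 gen tag_def winv_def algebra_simps)
    moreover have "(True, a e) \<in> Y" for e using a(1) by (simp add: Y_def)
    moreover have "v \<notin> Y" by (simp add: v Y_def)
    moreover have AW: "A (True, a e) = tag False (W e)" for e
      using Wc[OF a(2)[of e], of 0] by (simp add: A_def)
    ultimately have "fy.subst_word (R v) = inv_word (A (True, a (?i + k))) @ A (True, a ?i) @ [(v, True)]"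
      by (simp add: fy.subst_word_def fy.subst_def)
    also have "[(v, True)] = tag False (xpow n (?i + m) 1)"
      using v by (simp add: xpow1 gen tag_def ag)
    finally show "tag False (\<rho>' (int (snd v) + (1 - m))) = fy.subst_word (R v)"
      by (simp add: v \<rho>'_def tag_winv AW)
  qed
  also have "cpx X X (\<lambda>v. fy.subst_word (R v)) homotopy_equivalent_space cpx (X \<union> Y) (X \<union> Y) R"
    using fy.eliminate_generators[OF RX] homotopy_equivalent_space_sym by blast
  also have "cpx (X \<union> Y) (X \<union> Y) R = cpx (Y \<union> X) (Y \<union> X) R"
    by (simp add: Un_commute)
  also have "cpx (Y \<union> X) (Y \<union> X) R homotopy_equivalent_space cpx Y Y (\<lambda>v. fx.subst_word (R v))"
    by (rule fx.eliminate_generators[OF RY])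
  \<comment> \<open>The substitution lowers subscripts by m, so W i y_i^-1 turns into V (i - m)
    y_i^-1, which is \<open>\<tau> (i - m)\<close>. With i = \<open>int (snd v) + 1\<close> the
    offset is 1 - m once more.\<close>
  also have "cpx Y Y (\<lambda>v. fx.subst_word (R v)) = cpx Y Y (\<lambda>v. tag True (\<tau> (int (snd v) + (1 - m))))"
  proof (rule cpx_cong)
    fix v assume "v \<in> Y"
    then obtain g where v: "v = (True, g)" "g < n" by (auto simp: Y_def)
    let ?D = "\<lambda>i. xpow n i (-1) @ xpow n (i + k) 1"
    \<comment> \<open>Solving y_(j+k)^-1 y_j x_(j+m) = 1 for j = i - m gives x_i = y_(i-m)^-1
      y_(i-m+k).\<close>
    have g: "fx.subst_word (tag False (gen n i)) = tag True (?D (i - m))" for i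
    proof -
      have "(False, a i) \<in> X" using a(1) by (simp add: X_def)
      then have "fx.subst_word (tag False (gen n i)) = inv_word (B (False, a i))"
        by (simp add: gen tag_def fx.subst_def)
      also have "B (False, a i) = tag True (winv (?D (i - m)))"
        using gen_cong[OF a'[of i "- m"]] gen_cong[OF a'[of i "k - m"]]
        by (simp add: B_def xpow1 winv_eq_inv_word inv_word_append algebra_simps)
      finally show ?thesis by (simp add: tag_winv)
    qed
    \<comment> \<open>Substitution commutes with inversion and concatenation, hence with powers of
      either sign.\<close>
    have p: "fx.subst_word (tag False (wpow w e)) = tag True (wpow z e)"
      if "fx.subst_word (tag False w) = tag True z" for w z e
    proof -
      have "fx.subst_word (tag False (winv w)) = tag True (winv z)"
        using that by (simp add: tag_winv fx.subst_word_inv_word)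
      moreover have "fx.subst_word (tag False (concat (replicate k w))) = tag True (concat (replicate k z))"
        if "fx.subst_word (tag False w) = tag True z" for w z k
        using that by (induction k) auto
      ultimately show ?thesis using that by (simp add: wpow_def)
    qed
    have "fx.subst_word (tag False (concat (map F xs))) = tag True (concat (map H xs))"
      if "\<And>x. fx.subst_word (tag False (F x)) = tag True (H x)" for F H and xs :: "nat list"
      using that by (induction xs) auto
    from this[of "\<lambda>j. xpow n (i + Q j) (\<epsilon> j)" "\<lambda>j. wpow (?D (i - m + Q j)) (\<epsilon> j)" "[0..<r]" for i]
    have W: "fx.subst_word (tag False (W i)) = tag True (V (i - m))" for i
      using p[OF g] by (simp add: W_def V_def xpow_def algebra_simps)
    have "v \<notin> X" by (simp add: v X_def)
    then have "fx.subst_word (R v) = tag True (V (int g + 1 - m)) @ [(v, False)]"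
      by (simp add: R_def v A_def W fx.subst_def)
    also have "[(v, False)] = tag True (xpow n (int g + 1) (-1))"
      using v by (simp add: xpow1 gen tag_def ag winv_def)
    finally show "fx.subst_word (R v) = tag True (\<tau> (int (snd v) + (1 - m)))"
      by (simp add: \<tau>_def v algebra_simps)
  qed
  also have "cpx Y Y (\<lambda>v. tag True (\<tau> (int (snd v) + (1 - m)))) homotopy_equivalent_space
      pres_complex n (cyclic_rels n (\<tau> d))"
  proof -
    have "pres_complex n (cyclic_rels n (\<tau> d)) homeomorphic_space cpx Y Y (\<lambda>v. tag True (\<tau> (int (snd v) + (1 - m))))"
      unfolding Y_def
    proof (rule cyclic_complex[OF n])
      show "\<tau> i = \<tau> i'" if "i mod int n = i' mod int n" for i i'
        using xc[OF that] Vc[OF that] by (simp add: \<tau>_def)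
      show "shift n j (\<tau> d) = \<tau> (d + int j)" for j
        using n by (simp add: \<tau>_def shift_append shift_xpow shV algebra_simps)
      show "fst ` set (\<tau> i) \<subseteq> {..<n}" for i
        using Vn fst_set_xpow[OF n] by (simp add: \<tau>_def image_Un)
    qed simp
    then show ?thesis
      using homeomorphic_imp_homotopy_equivalent_space homotopy_equivalent_space_sym by blast
  qed
  finally show ?thesis
    by (simp add: cyc_hequiv_def pres_homotopy_equivalent_def \<rho>_def \<tau>_def)
qed

theorem theorem3p3:
  fixes n r :: nat
  assumes "n \<ge> 2" and "r \<ge> 1"
  shows "(\<forall>(k::int) (q::nat \<Rightarrow> int) (\<epsilon>::nat \<Rightarrow> int).
            cyc_hequiv n
              (concat (map (\<lambda>j. xpow n (1 + (if j = 0 then 0 else q j)) (\<epsilon> j)) [0..<r])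
               @ xpow n (1 + q r) 1
               @ winv (concat (map (\<lambda>j. xpow n (1 + k + (if j = 0 then 0 else q j)) (\<epsilon> j)) [0..<r])))
              (concat (map (\<lambda>j. wpow (xpow n (1 + (if j = 0 then 0 else q j)) (-1)
                                       @ xpow n (1 + (if j = 0 then 0 else q j) + k) 1) (\<epsilon> j)) [0..<r])
               @ xpow n (1 + q r) (-1)))
       \<and> (\<forall>p::nat \<Rightarrow> int. (\<forall>j<r. 0 \<le> p j \<and> p j \<le> int n - 1) \<longrightarrow>
            (let P = (\<lambda>j. if j = r then -1 else p j) in
            cyc_hequiv n
              (concat (map (\<lambda>j. xpow n (P j + int j) 1) [0..<Suc r])
               @ winv (concat (map (\<lambda>j. xpow n (P j + int j + 1) 1) [0..<r])))
              (concat (map (\<lambda>j. xpow n (int j + 1 + (P j - P 0)) (-1)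
                                 @ xpow n (int j + 2 + (P j - P 0)) 1) [0..<r])
               @ xpow n (1 + int r + (P r - P 0)) (-1))))"
proof (intro conjI allI impI)
  have n: "0 < n" using assms by simp
  fix k :: int and q \<epsilon> :: "nat \<Rightarrow> int"
  \<comment> \<open>The instance c = d = 1 and m = q r, where Q is 0 at the first factor and q
    elsewhere.\<close>
  show "cyc_hequiv n
              (concat (map (\<lambda>j. xpow n (1 + (if j = 0 then 0 else q j)) (\<epsilon> j)) [0..<r])
               @ xpow n (1 + q r) 1
               @ winv (concat (map (\<lambda>j. xpow n (1 + k + (if j = 0 then 0 else q j)) (\<epsilon> j)) [0..<r])))
              (concat (map (\<lambda>j. wpow (xpow n (1 + (if j = 0 then 0 else q j)) (-1)
                                       @ xpow n (1 + (if j = 0 then 0 else q j) + k) 1) (\<epsilon> j)) [0..<r])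
               @ xpow n (1 + q r) (-1))"
    by (rule cyc_hequiv_eliminate[OF n])
next
  have n: "0 < n" using assms by simp
  fix p :: "nat \<Rightarrow> int"
  define P where "P = (\<lambda>j. if j = r then -1 else p j)"
  \<comment> \<open>With c = P 0 the subscripts c + Q j become P j + j; also d = 1, k = 1, m = Q r,
    and all exponents are 1. The two words start at different subscripts, which is why c and d are
    independent in \<open>cyc_hequiv_eliminate\<close>.\<close>
  let ?Q = "\<lambda>j. P j - P 0 + int j"
  have "cyc_hequiv n
      (concat (map (\<lambda>j. xpow n (P 0 + ?Q j) 1) [0..<r]) @ xpow n (P 0 + ?Q r) 1 @
        winv (concat (map (\<lambda>j. xpow n (P 0 + 1 + ?Q j) 1) [0..<r])))
      (concat (map (\<lambda>j. wpow (xpow n (1 + ?Q j) (-1) @ xpow n (1 + ?Q j + 1) 1) 1) [0..<r]) @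
        xpow n (1 + ?Q r) (-1))"
    by (rule cyc_hequiv_eliminate[OF n])
  also have "(\<lambda>j. xpow n (P 0 + ?Q j) 1) = (\<lambda>j. xpow n (P j + int j) 1)" by simp
  also have "(\<lambda>j. xpow n (P 0 + 1 + ?Q j) 1) = (\<lambda>j. xpow n (P j + int j + 1) 1)"
    by (simp add: algebra_simps)
  also have "(\<lambda>j. wpow (xpow n (1 + ?Q j) (-1) @ xpow n (1 + ?Q j + 1) 1) 1) =
      (\<lambda>j. xpow n (int j + 1 + (P j - P 0)) (-1) @ xpow n (int j + 2 + (P j - P 0)) 1)"
    by (simp add: algebra_simps)
  finally show "let P = (\<lambda>j. if j = r then -1 else p j) in
            cyc_hequiv n
              (concat (map (\<lambda>j. xpow n (P j + int j) 1) [0..<Suc r])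
               @ winv (concat (map (\<lambda>j. xpow n (P j + int j + 1) 1) [0..<r])))
              (concat (map (\<lambda>j. xpow n (int j + 1 + (P j - P 0)) (-1)
                                 @ xpow n (int j + 2 + (P j - P 0)) 1) [0..<r])
               @ xpow n (1 + int r + (P r - P 0)) (-1))"
    unfolding Let_def P_def[symmetric] by (simp add: algebra_simps)
qed

end
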